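(* Let $P$ be a poset and let $\varphi:P\to[0]$ be the unique map to the one-element poset. Then the canonical map $$dcr: D\,T(N\varphi)\to M(N\varphi)$$ is an isomorphism. (In words: the desingularization of the cone on $NP$ is the reduced mapping cylinder of the unique map $NP\to\Delta[0]$.)
   Context: $N$ denotes the nerve, posets being regarded as small categories. A simplicial set is non-singular if the representing map $\Delta[n]\to X$ of each of its non-degenerate simplices is degreewise injective. $nsSet\subseteq sSet$ is the full subcategory of non-singular simplicial sets; $D:sSet\to nsSet$ (desingularization) is the left adjoint of the inclusion, with unit $\eta$. The nerve of a poset is non-singular. Mapping cylinders. For an order-preserving map $\varphi:P\to R$ of posets, let $i_0:P\to P\times[1]$, $p\mapsto(p,0)$, where $[1]=\{0<1\}$. The (backwards) topological mapping cylinder is the pushout in $sSet$: $T(N\varphi)=N(P\times[1])\sqcup_{NP}NR$ (along $Ni_0$ and $N\varphi$). The (backwards) reduced mapping cylinder is $M(N\varphi)=N(P\times[1]\sqcup_P R)$, with the pushout (along $i_0$ and $\varphi$) taken in the category of posets. The canonical map $cr:T(N\varphi)\to M(N\varphi)$ is the cylinder reduction map; as $M(N\varphi)$ is non-singular, $cr$ factors uniquely through $\eta:T(N\varphi)\to D\,T(N\varphi)$, giving $dcr:D\,T(N\varphi)\to M(N\varphi)$. *)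

theory Defs
  imports Main "HOL-Library.FuncSet"
begin

section \<open>Posets\<close>

text \<open>
  A poset is a relation \<open>P\<close> with \<^prop>\<open>Partial_order P\<close>; its underlying set is
  \<^term>\<open>Field P\<close>, which may be empty. Maps are extensional, so that equality of morphisms is
  equality of functions.
\<close>

definition poset_hom :: "'a rel \<Rightarrow> 'b rel \<Rightarrow> ('a \<Rightarrow> 'b) set" where
  "poset_hom P R = {f \<in> Field P \<rightarrow>\<^sub>E Field R. \<forall>(x, y) \<in> P. (f x, f y) \<in> R}"

definition ordinal :: "nat \<Rightarrow> nat rel" where
  "ordinal n = {(i, j). i \<le> j \<and> j \<le> n}"

definition poset_prod :: "'a rel \<Rightarrow> 'b rel \<Rightarrow> ('a \<times> 'b) rel" where
  "poset_prod P R = {((p, r), (p', r')). (p, p') \<in> P \<and> (r, r') \<in> R}"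

text \<open>
  The pushout of \<open>Q \<leftarrow> P \<rightarrow> R\<close> in the category of posets: generate a preorder on the disjoint
  union in which \<open>f p\<close> and \<open>g p\<close> are equivalent, then identify equivalent elements. The universal
  property is \<open>poset_pushout_universal\<close> below.
\<close>

definition glue_preorder ::
    "'a rel \<Rightarrow> 'b rel \<Rightarrow> 'c rel \<Rightarrow> ('a \<Rightarrow> 'b) \<Rightarrow> ('a \<Rightarrow> 'c) \<Rightarrow> ('b + 'c) rel" where
  "glue_preorder P Q R f g =
    ({(Inl x, Inl x') |x x'. (x, x') \<in> Q} \<union> {(Inr y, Inr y') |y y'. (y, y') \<in> R} \<union>
     {(Inl (f p), Inr (g p)) |p. p \<in> Field P} \<union> {(Inr (g p), Inl (f p)) |p. p \<in> Field P})\<^sup>+"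

definition iso_class :: "'a rel \<Rightarrow> 'a \<Rightarrow> 'a set" where
  "iso_class r x = {y. (x, y) \<in> r \<and> (y, x) \<in> r}"

definition poset_reflection :: "'a rel \<Rightarrow> 'a set rel" where
  "poset_reflection r = {(iso_class r x, iso_class r y) |x y. (x, y) \<in> r}"

definition poset_pushout ::
    "'a rel \<Rightarrow> 'b rel \<Rightarrow> 'c rel \<Rightarrow> ('a \<Rightarrow> 'b) \<Rightarrow> ('a \<Rightarrow> 'c) \<Rightarrow> ('b + 'c) set rel" where
  "poset_pushout P Q R f g = poset_reflection (glue_preorder P Q R f g)"

definition poset_pushout_inl ::
    "'a rel \<Rightarrow> 'b rel \<Rightarrow> 'c rel \<Rightarrow> ('a \<Rightarrow> 'b) \<Rightarrow> ('a \<Rightarrow> 'c) \<Rightarrow> 'b \<Rightarrow> ('b + 'c) set" where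
  "poset_pushout_inl P Q R f g =
    (\<lambda>x \<in> Field Q. iso_class (glue_preorder P Q R f g) (Inl x))"

definition poset_pushout_inr ::
    "'a rel \<Rightarrow> 'b rel \<Rightarrow> 'c rel \<Rightarrow> ('a \<Rightarrow> 'b) \<Rightarrow> ('a \<Rightarrow> 'c) \<Rightarrow> 'c \<Rightarrow> ('b + 'c) set" where
  "poset_pushout_inr P Q R f g =
    (\<lambda>y \<in> Field R. iso_class (glue_preorder P Q R f g) (Inr y))"


section \<open>Simplicial sets\<close>

abbreviation Delta_hom :: "nat \<Rightarrow> nat \<Rightarrow> (nat \<Rightarrow> nat) set" where
  "Delta_hom m n \<equiv> poset_hom (ordinal m) (ordinal n)"

text \<open>For \<open>\<alpha> : [m] \<rightarrow> [n]\<close>, the induced map from \<open>n\<close>-simplices to \<open>m\<close>-simplices is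
  \<open>act X m n \<alpha>\<close>.\<close>

record 'a sset =
  simplices :: "nat \<Rightarrow> 'a set"
  act :: "nat \<Rightarrow> nat \<Rightarrow> (nat \<Rightarrow> nat) \<Rightarrow> 'a \<Rightarrow> 'a"

definition simplicial_set :: "'a sset \<Rightarrow> bool" where
  "simplicial_set X \<longleftrightarrow>
    (\<forall>m n. \<forall>\<alpha> \<in> Delta_hom m n. act X m n \<alpha> \<in> simplices X n \<rightarrow> simplices X m) \<and>
    (\<forall>n. \<forall>x \<in> simplices X n. act X n n (\<lambda>i \<in> {..n}. i) x = x) \<and>
    (\<forall>k m n. \<forall>\<alpha> \<in> Delta_hom k m. \<forall>\<beta> \<in> Delta_hom m n. \<forall>x \<in> simplices X n.
      act X k n (compose {..k} \<beta> \<alpha>) x = act X k m \<alpha> (act X m n \<beta> x))"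

definition sset_hom :: "'a sset \<Rightarrow> 'b sset \<Rightarrow> (nat \<Rightarrow> 'a \<Rightarrow> 'b) set" where
  "sset_hom X Y = {F. (\<forall>n. F n \<in> simplices X n \<rightarrow>\<^sub>E simplices Y n) \<and>
    (\<forall>m n. \<forall>\<alpha> \<in> Delta_hom m n. \<forall>x \<in> simplices X n.
      F m (act X m n \<alpha> x) = act Y m n \<alpha> (F n x))}"

definition sset_id :: "'a sset \<Rightarrow> nat \<Rightarrow> 'a \<Rightarrow> 'a" where
  "sset_id X = (\<lambda>n. \<lambda>x \<in> simplices X n. x)"

text \<open>\<open>sset_comp X G F\<close> is \<open>G \<circ> F\<close> for \<open>F : X \<rightarrow> Y\<close>.\<close>

definition sset_comp ::
    "'a sset \<Rightarrow> (nat \<Rightarrow> 'b \<Rightarrow> 'c) \<Rightarrow> (nat \<Rightarrow> 'a \<Rightarrow> 'b) \<Rightarrow> nat \<Rightarrow> 'a \<Rightarrow> 'c" where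
  "sset_comp X G F = (\<lambda>n. compose (simplices X n) (G n) (F n))"

definition sset_iso :: "'a sset \<Rightarrow> 'b sset \<Rightarrow> (nat \<Rightarrow> 'a \<Rightarrow> 'b) \<Rightarrow> bool" where
  "sset_iso X Y F \<longleftrightarrow> F \<in> sset_hom X Y \<and>
    (\<exists>G \<in> sset_hom Y X. sset_comp X G F = sset_id X \<and> sset_comp Y F G = sset_id Y)"

definition nerve :: "'a rel \<Rightarrow> (nat \<Rightarrow> 'a) sset" where
  "nerve P = \<lparr>simplices = (\<lambda>n. poset_hom (ordinal n) P),
              act = (\<lambda>m n \<alpha> x. compose {..m} x \<alpha>)\<rparr>"

definition nerve_map :: "'a rel \<Rightarrow> ('a \<Rightarrow> 'b) \<Rightarrow> nat \<Rightarrow> (nat \<Rightarrow> 'a) \<Rightarrow> nat \<Rightarrow> 'b" where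
  "nerve_map P f = (\<lambda>n. \<lambda>x \<in> simplices (nerve P) n. compose {..n} f x)"

abbreviation std_simplex :: "nat \<Rightarrow> (nat \<Rightarrow> nat) sset" where
  "std_simplex n \<equiv> nerve (ordinal n)"

definition representing_map :: "'a sset \<Rightarrow> nat \<Rightarrow> 'a \<Rightarrow> nat \<Rightarrow> (nat \<Rightarrow> nat) \<Rightarrow> 'a" where
  "representing_map X n x = (\<lambda>m. \<lambda>\<alpha> \<in> simplices (std_simplex n) m. act X m n \<alpha> x)"

definition degenerate :: "'a sset \<Rightarrow> nat \<Rightarrow> 'a \<Rightarrow> bool" where
  "degenerate X n x \<longleftrightarrow>
    (\<exists>m < n. \<exists>\<sigma> \<in> Delta_hom n m. \<sigma> ` {..n} = {..m} \<and> (\<exists>y \<in> simplices X m. x = act X n m \<sigma> y))"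

definition nonsingular :: "'a sset \<Rightarrow> bool" where
  "nonsingular X \<longleftrightarrow>
    (\<forall>n. \<forall>x \<in> simplices X n. \<not> degenerate X n x \<longrightarrow>
      (\<forall>m. inj_on (representing_map X n x m) (simplices (std_simplex n) m)))"


subsection \<open>Quotients and pushouts\<close>

definition sset_congruence :: "'a sset \<Rightarrow> (nat \<Rightarrow> 'a rel) \<Rightarrow> bool" where
  "sset_congruence X E \<longleftrightarrow> (\<forall>n. equiv (simplices X n) (E n)) \<and>
    (\<forall>m n. \<forall>\<alpha> \<in> Delta_hom m n. \<forall>(x, y) \<in> E n. (act X m n \<alpha> x, act X m n \<alpha> y) \<in> E m)"

text \<open>For a congruence \<open>E\<close>, the set \<open>E m `` (act X m n \<alpha> ` c)\<close> is the class of
  \<open>act X m n \<alpha> x\<close> for any \<open>x \<in> c\<close>.\<close>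

definition sset_quotient :: "'a sset \<Rightarrow> (nat \<Rightarrow> 'a rel) \<Rightarrow> 'a set sset" where
  "sset_quotient X E = \<lparr>simplices = (\<lambda>n. simplices X n // E n),
                        act = (\<lambda>m n \<alpha> c. E m `` (act X m n \<alpha> ` c))\<rparr>"

definition sset_proj :: "'a sset \<Rightarrow> (nat \<Rightarrow> 'a rel) \<Rightarrow> nat \<Rightarrow> 'a \<Rightarrow> 'a set" where
  "sset_proj X E = (\<lambda>n. \<lambda>x \<in> simplices X n. E n `` {x})"

definition sset_coprod :: "'a sset \<Rightarrow> 'b sset \<Rightarrow> ('a + 'b) sset" where
  "sset_coprod X Y = \<lparr>simplices = (\<lambda>n. simplices X n <+> simplices Y n),
                      act = (\<lambda>m n \<alpha>. map_sum (act X m n \<alpha>) (act Y m n \<alpha>))\<rparr>"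

definition glue_rel ::
    "'a sset \<Rightarrow> 'b sset \<Rightarrow> 'c sset \<Rightarrow> (nat \<Rightarrow> 'a \<Rightarrow> 'b) \<Rightarrow> (nat \<Rightarrow> 'a \<Rightarrow> 'c) \<Rightarrow>
      nat \<Rightarrow> ('b + 'c) rel" where
  "glue_rel A X Y f g n =
    ({(Inl (f n a), Inr (g n a)) |a. a \<in> simplices A n} \<union>
     {(Inr (g n a), Inl (f n a)) |a. a \<in> simplices A n})\<^sup>* \<inter>
    (simplices (sset_coprod X Y) n \<times> simplices (sset_coprod X Y) n)"

text \<open>
  The pushout of \<open>X \<leftarrow> A \<rightarrow> Y\<close> in simplicial sets; the intersection in \<open>glue_rel\<close> only removes
  the reflexive pairs outside the carrier. The map \<open>sset_pushout_map\<close> is the one given by the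
  universal property, proved as \<open>sset_pushout_universal\<close> below.
\<close>

definition sset_pushout ::
    "'a sset \<Rightarrow> 'b sset \<Rightarrow> 'c sset \<Rightarrow> (nat \<Rightarrow> 'a \<Rightarrow> 'b) \<Rightarrow> (nat \<Rightarrow> 'a \<Rightarrow> 'c) \<Rightarrow>
      ('b + 'c) set sset" where
  "sset_pushout A X Y f g = sset_quotient (sset_coprod X Y) (glue_rel A X Y f g)"

definition sset_pushout_inl ::
    "'a sset \<Rightarrow> 'b sset \<Rightarrow> 'c sset \<Rightarrow> (nat \<Rightarrow> 'a \<Rightarrow> 'b) \<Rightarrow> (nat \<Rightarrow> 'a \<Rightarrow> 'c) \<Rightarrow>
      nat \<Rightarrow> 'b \<Rightarrow> ('b + 'c) set" where
  "sset_pushout_inl A X Y f g = (\<lambda>n. \<lambda>x \<in> simplices X n. glue_rel A X Y f g n `` {Inl x})"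

definition sset_pushout_inr ::
    "'a sset \<Rightarrow> 'b sset \<Rightarrow> 'c sset \<Rightarrow> (nat \<Rightarrow> 'a \<Rightarrow> 'b) \<Rightarrow> (nat \<Rightarrow> 'a \<Rightarrow> 'c) \<Rightarrow>
      nat \<Rightarrow> 'c \<Rightarrow> ('b + 'c) set" where
  "sset_pushout_inr A X Y f g = (\<lambda>n. \<lambda>y \<in> simplices Y n. glue_rel A X Y f g n `` {Inr y})"

definition sset_pushout_map ::
    "'a sset \<Rightarrow> 'b sset \<Rightarrow> 'c sset \<Rightarrow> (nat \<Rightarrow> 'a \<Rightarrow> 'b) \<Rightarrow> (nat \<Rightarrow> 'a \<Rightarrow> 'c) \<Rightarrow> 'd sset \<Rightarrow>
      (nat \<Rightarrow> 'b \<Rightarrow> 'd) \<Rightarrow> (nat \<Rightarrow> 'c \<Rightarrow> 'd) \<Rightarrow> nat \<Rightarrow> ('b + 'c) set \<Rightarrow> 'd" where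
  "sset_pushout_map A X Y f g Z u v =
    (THE h. h \<in> sset_hom (sset_pushout A X Y f g) Z \<and>
            sset_comp X h (sset_pushout_inl A X Y f g) = u \<and>
            sset_comp Y h (sset_pushout_inr A X Y f g) = v)"


subsection \<open>Desingularization\<close>

text \<open>
  \<open>D X\<close> is the largest non-singular quotient of \<open>X\<close>: two simplices are identified iff they are
  identified in every non-singular quotient of \<open>X\<close>. Equivalently, it is the image of \<open>X\<close> in the
  product of all its non-singular quotients. The lemmas \<open>nonsingular_desing\<close> and
  \<open>desing_universal\<close> below, the latter for target simplicial sets over an arbitrary type, say
  that this is the left adjoint of the inclusion of non-singular simplicial sets into simplicial
  sets, with unit \<open>desing_unit\<close>.
\<close>

definition desing_rel :: "'a sset \<Rightarrow> nat \<Rightarrow> 'a rel" where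
  "desing_rel X n = {(x, y) \<in> simplices X n \<times> simplices X n.
    \<forall>E. sset_congruence X E \<and> nonsingular (sset_quotient X E) \<longrightarrow> (x, y) \<in> E n}"

definition desing :: "'a sset \<Rightarrow> 'a set sset" where
  "desing X = sset_quotient X (desing_rel X)"

definition desing_unit :: "'a sset \<Rightarrow> nat \<Rightarrow> 'a \<Rightarrow> 'a set" where
  "desing_unit X = sset_proj X (desing_rel X)"

definition desing_factor ::
    "'a sset \<Rightarrow> 'b sset \<Rightarrow> (nat \<Rightarrow> 'a \<Rightarrow> 'b) \<Rightarrow> nat \<Rightarrow> 'a set \<Rightarrow> 'b" where
  "desing_factor X Y f = (THE h. h \<in> sset_hom (desing X) Y \<and> sset_comp X h (desing_unit X) = f)"


section \<open>Mapping cylinders\<close>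

text \<open>
  Throughout, \<open>\<phi> : P \<rightarrow> R\<close>; the gluing is along the inclusion at \<open>0\<close>. The maps \<open>cr\<close> and \<open>dcr\<close>
  are given by universal properties; \<open>cr_spec\<close> and \<open>dcr_spec\<close> below show that they satisfy their
  defining equations.
\<close>

definition cyl_i0 :: "'a rel \<Rightarrow> 'a \<Rightarrow> 'a \<times> nat" where
  "cyl_i0 P = (\<lambda>p \<in> Field P. (p, 0))"

definition top_cyl ::
    "'a rel \<Rightarrow> 'b rel \<Rightarrow> ('a \<Rightarrow> 'b) \<Rightarrow> ((nat \<Rightarrow> 'a \<times> nat) + (nat \<Rightarrow> 'b)) set sset" where
  "top_cyl P R \<phi> =
    sset_pushout (nerve P) (nerve (poset_prod P (ordinal 1))) (nerve R)
      (nerve_map P (cyl_i0 P)) (nerve_map P \<phi>)"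

definition red_cyl :: "'a rel \<Rightarrow> 'b rel \<Rightarrow> ('a \<Rightarrow> 'b) \<Rightarrow> (nat \<Rightarrow> ('a \<times> nat + 'b) set) sset" where
  "red_cyl P R \<phi> = nerve (poset_pushout P (poset_prod P (ordinal 1)) R (cyl_i0 P) \<phi>)"

definition cr ::
    "'a rel \<Rightarrow> 'b rel \<Rightarrow> ('a \<Rightarrow> 'b) \<Rightarrow>
      nat \<Rightarrow> ((nat \<Rightarrow> 'a \<times> nat) + (nat \<Rightarrow> 'b)) set \<Rightarrow> nat \<Rightarrow> ('a \<times> nat + 'b) set" where
  "cr P R \<phi> =
    sset_pushout_map (nerve P) (nerve (poset_prod P (ordinal 1))) (nerve R)
      (nerve_map P (cyl_i0 P)) (nerve_map P \<phi>) (red_cyl P R \<phi>)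
      (nerve_map (poset_prod P (ordinal 1))
        (poset_pushout_inl P (poset_prod P (ordinal 1)) R (cyl_i0 P) \<phi>))
      (nerve_map R (poset_pushout_inr P (poset_prod P (ordinal 1)) R (cyl_i0 P) \<phi>))"

definition dcr ::
    "'a rel \<Rightarrow> 'b rel \<Rightarrow> ('a \<Rightarrow> 'b) \<Rightarrow>
      nat \<Rightarrow> ((nat \<Rightarrow> 'a \<times> nat) + (nat \<Rightarrow> 'b)) set set \<Rightarrow> nat \<Rightarrow> ('a \<times> nat + 'b) set" where
  "dcr P R \<phi> = desing_factor (top_cyl P R \<phi>) (red_cyl P R \<phi>) (cr P R \<phi>)"


section \<open>Universal properties\<close>

subsection \<open>Posets\<close>

lemma Field_ordinal [simp]: "Field (ordinal n) = {..n}"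
  by (auto simp: ordinal_def Field_def)

lemma ordinal_iff: "(i, j) \<in> ordinal n \<longleftrightarrow> i \<le> j \<and> j \<le> n"
  by (simp add: ordinal_def)

lemma Partial_order_ordinal: "Partial_order (ordinal n)"
  by (auto simp: partial_order_on_def preorder_on_def refl_on_def trans_def antisym_def
      ordinal_iff Field_def)

lemma poset_hom_ordinal_iff:
  "x \<in> poset_hom (ordinal n) P \<longleftrightarrow>
    x \<in> {..n} \<rightarrow>\<^sub>E Field P \<and> (\<forall>i j. i \<le> j \<longrightarrow> j \<le> n \<longrightarrow> (x i, x j) \<in> P)"
  by (fastforce simp: poset_hom_def ordinal_iff)

lemma poset_hom_extensional: "f \<in> poset_hom P R \<Longrightarrow> f \<in> extensional (Field P)"
  by (auto simp: poset_hom_def PiE_def)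

lemma poset_hom_mem: "f \<in> poset_hom P R \<Longrightarrow> x \<in> Field P \<Longrightarrow> f x \<in> Field R"
  by (auto simp: poset_hom_def)

lemma poset_hom_mono: "f \<in> poset_hom P R \<Longrightarrow> (x, y) \<in> P \<Longrightarrow> (f x, f y) \<in> R"
  by (auto simp: poset_hom_def)

lemma poset_hom_comp:
  assumes "f \<in> poset_hom P Q" "g \<in> poset_hom Q R"
  shows "compose (Field P) g f \<in> poset_hom P R"
proof -
  have "compose (Field P) g f \<in> Field P \<rightarrow>\<^sub>E Field R"
    using poset_hom_mem[OF assms(1)] poset_hom_mem[OF assms(2)] by (auto simp: compose_def)
  moreover have "(compose (Field P) g f x, compose (Field P) g f y) \<in> R" if "(x, y) \<in> P" for x y
    using poset_hom_mono[OF assms(2) poset_hom_mono[OF assms(1) that]] that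
    by (simp add: compose_def FieldI1 FieldI2)
  ultimately show ?thesis by (auto simp: poset_hom_def)
qed

lemma Delta_comp:
  "\<alpha> \<in> Delta_hom k m \<Longrightarrow> f \<in> poset_hom (ordinal m) R \<Longrightarrow>
    compose {..k} f \<alpha> \<in> poset_hom (ordinal k) R"
  using poset_hom_comp[of \<alpha> "ordinal k" "ordinal m" f R] by simp

lemma Delta_le: "\<alpha> \<in> Delta_hom m n \<Longrightarrow> i \<le> m \<Longrightarrow> \<alpha> i \<le> n"
  using poset_hom_mem[of \<alpha> "ordinal m" "ordinal n" i] by simp

lemma Delta_mono: "\<alpha> \<in> Delta_hom m n \<Longrightarrow> i \<le> j \<Longrightarrow> j \<le> m \<Longrightarrow> \<alpha> i \<le> \<alpha> j"
  using poset_hom_mono[of \<alpha> "ordinal m" "ordinal n" i j] by (simp add: ordinal_iff)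

lemma Partial_order_refl: "Partial_order P \<Longrightarrow> x \<in> Field P \<Longrightarrow> (x, x) \<in> P"
  by (auto simp: partial_order_on_def preorder_on_def refl_on_def)

lemma Partial_order_trans: "Partial_order P \<Longrightarrow> (x, y) \<in> P \<Longrightarrow> (y, z) \<in> P \<Longrightarrow> (x, z) \<in> P"
  by (auto simp: partial_order_on_def preorder_on_def dest: transD)

lemma Partial_order_antisym: "Partial_order P \<Longrightarrow> (x, y) \<in> P \<Longrightarrow> (y, x) \<in> P \<Longrightarrow> x = y"
  by (auto simp: partial_order_on_def dest: antisymD)

lemma Field_poset_prod:
  assumes "Partial_order P" "Partial_order R"
  shows "Field (poset_prod P R) = Field P \<times> Field R"
proof
  show "Field (poset_prod P R) \<subseteq> Field P \<times> Field R"
    by (auto simp: poset_prod_def Field_def)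
  show "Field P \<times> Field R \<subseteq> Field (poset_prod P R)"
  proof
    fix z assume "z \<in> Field P \<times> Field R"
    then have "(z, z) \<in> poset_prod P R"
      using assms by (auto simp: poset_prod_def partial_order_on_def preorder_on_def refl_on_def)
    then show "z \<in> Field (poset_prod P R)" by (rule FieldI1)
  qed
qed

lemma Partial_order_prod:
  assumes "Partial_order P" "Partial_order R"
  shows "Partial_order (poset_prod P R)"
proof -
  have F: "Field (poset_prod P R) = Field P \<times> Field R"
    by (rule Field_poset_prod[OF assms])
  show ?thesis
    unfolding partial_order_on_def preorder_on_def
  proof (intro conjI)
    show "poset_prod P R \<subseteq> Field (poset_prod P R) \<times> Field (poset_prod P R)"
      by (auto intro: FieldI1 FieldI2)
    show "refl_on (Field (poset_prod P R)) (poset_prod P R)"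
      unfolding F using assms
      by (auto simp: poset_prod_def partial_order_on_def preorder_on_def refl_on_def)
    show "trans (poset_prod P R)"
    proof (rule transI)
      fix x y z assume "(x, y) \<in> poset_prod P R" "(y, z) \<in> poset_prod P R"
      then have "(fst x, fst y) \<in> P" "(fst y, fst z) \<in> P" "(snd x, snd y) \<in> R" "(snd y, snd z) \<in> R"
        by (auto simp: poset_prod_def)
      then have "(fst x, fst z) \<in> P" "(snd x, snd z) \<in> R"
        using Partial_order_trans[OF assms(1)] Partial_order_trans[OF assms(2)] by metis+
      then show "(x, z) \<in> poset_prod P R" by (cases x, cases z) (simp add: poset_prod_def)
    qed
    show "antisym (poset_prod P R)"
      by (rule antisymI)
        (auto simp: poset_prod_def dest: Partial_order_antisym[OF assms(1)]
          Partial_order_antisym[OF assms(2)])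
  qed
qed

lemma cyl_i0_hom:
  assumes "Partial_order P"
  shows "cyl_i0 P \<in> poset_hom P (poset_prod P (ordinal 1))"
proof -
  have "(cyl_i0 P x, cyl_i0 P y) \<in> poset_prod P (ordinal 1)" if "(x, y) \<in> P" for x y
    using that FieldI1[OF that] FieldI2[OF that] by (simp add: cyl_i0_def poset_prod_def ordinal_iff)
  moreover have "cyl_i0 P \<in> Field P \<rightarrow>\<^sub>E Field (poset_prod P (ordinal 1))"
    unfolding Field_poset_prod[OF assms Partial_order_ordinal] by (auto simp: cyl_i0_def)
  ultimately show ?thesis
    unfolding poset_hom_def by blast
qed

lemma iso_class_eq_iff:
  assumes "refl_on A r" "trans r" "x \<in> A" "y \<in> A"
  shows "iso_class r x = iso_class r y \<longleftrightarrow> (x, y) \<in> r \<and> (y, x) \<in> r"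
proof
  assume "iso_class r x = iso_class r y"
  moreover have "y \<in> iso_class r y"
    using assms by (auto simp: iso_class_def refl_on_def)
  ultimately have "y \<in> iso_class r x" by simp
  then show "(x, y) \<in> r \<and> (y, x) \<in> r"
    by (simp add: iso_class_def)
next
  assume "(x, y) \<in> r \<and> (y, x) \<in> r"
  then show "iso_class r x = iso_class r y"
    using transD[OF assms(2)] unfolding iso_class_def by blast
qed

lemma poset_reflection_iff:
  assumes "refl_on A r" "trans r" "r \<subseteq> A \<times> A" "x \<in> A" "y \<in> A"
  shows "(iso_class r x, iso_class r y) \<in> poset_reflection r \<longleftrightarrow> (x, y) \<in> r"
proof
  assume "(iso_class r x, iso_class r y) \<in> poset_reflection r"
  then obtain x' y' where *: "iso_class r x = iso_class r x'"
      "iso_class r y = iso_class r y'" "(x', y') \<in> r"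
    by (auto simp: poset_reflection_def)
  then have "x' \<in> A" "y' \<in> A" using assms(3) by auto
  then have "(x, x') \<in> r" "(y', y) \<in> r"
    using * iso_class_eq_iff[OF assms(1,2)] assms(4,5) by auto
  then show "(x, y) \<in> r" using * assms(2) by (meson transD)
qed (auto simp: poset_reflection_def)

lemma Field_poset_reflection:
  assumes "refl_on A r" "r \<subseteq> A \<times> A"
  shows "Field (poset_reflection r) = iso_class r ` A"
proof
  show "Field (poset_reflection r) \<subseteq> iso_class r ` A"
    using assms(2) by (auto simp: poset_reflection_def Field_def)
  have "(iso_class r x, iso_class r x) \<in> poset_reflection r" if "x \<in> A" for x
    using assms(1) that by (auto simp: poset_reflection_def refl_on_def)
  then show "iso_class r ` A \<subseteq> Field (poset_reflection r)"
    by (auto intro: FieldI1)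
qed

lemma Partial_order_poset_reflection:
  assumes "refl_on A r" "trans r" "r \<subseteq> A \<times> A"
  shows "Partial_order (poset_reflection r)"
proof -
  note F = Field_poset_reflection[OF assms(1,3)]
  note I = poset_reflection_iff[OF assms]
  have sub: "\<exists>x\<in>A. \<exists>y\<in>A. C = iso_class r x \<and> D = iso_class r y \<and> (x, y) \<in> r"
    if "(C, D) \<in> poset_reflection r" for C D
    using that assms(3) unfolding poset_reflection_def by blast
  show ?thesis
    unfolding partial_order_on_def preorder_on_def
  proof (intro conjI)
    show "poset_reflection r \<subseteq> Field (poset_reflection r) \<times> Field (poset_reflection r)"
      by (auto intro: FieldI1 FieldI2)
    show "refl_on (Field (poset_reflection r)) (poset_reflection r)"
      unfolding F using assms(1) I by (auto simp: refl_on_def)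
    show "trans (poset_reflection r)"
    proof (rule transI)
      fix C D E
      assume CD: "(C, D) \<in> poset_reflection r" and DE: "(D, E) \<in> poset_reflection r"
      obtain x y where 1: "x \<in> A" "y \<in> A" "C = iso_class r x" "D = iso_class r y"
          "(x, y) \<in> r"
        using sub[OF CD] by blast
      obtain z where 2: "z \<in> A" "E = iso_class r z"
        using sub[OF DE] by blast
      have "(y, z) \<in> r" using DE 1 2 I by simp
      then have "(x, z) \<in> r" using 1 assms(2) by (meson transD)
      then show "(C, E) \<in> poset_reflection r" using 1 2 I by simp
    qed
    show "antisym (poset_reflection r)"
    proof (rule antisymI)
      fix C D
      assume CD: "(C, D) \<in> poset_reflection r" and DC: "(D, C) \<in> poset_reflection r"
      obtain x y where 1: "x \<in> A" "y \<in> A" "C = iso_class r x" "D = iso_class r y"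
          "(x, y) \<in> r"
        using sub[OF CD] by blast
      then have "(y, x) \<in> r" using DC I by simp
      then show "C = D" using 1 iso_class_eq_iff[OF assms(1,2)] by simp
    qed
  qed
qed

context
  fixes P :: "'a rel" and Q :: "'b rel" and R :: "'c rel" and f g
  assumes PO: "Partial_order P" "Partial_order Q" "Partial_order R"
    and f: "f \<in> poset_hom P Q" and g: "g \<in> poset_hom P R"
begin

lemma glue_preorder_carrier:
  "glue_preorder P Q R f g \<subseteq> (Field Q <+> Field R) \<times> (Field Q <+> Field R)"
  unfolding glue_preorder_def
  by (rule trancl_subset_Sigma)
    (auto intro: FieldI1 FieldI2 poset_hom_mem[OF f] poset_hom_mem[OF g])

lemma glue_preorder_refl: "refl_on (Field Q <+> Field R) (glue_preorder P Q R f g)"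
  by (auto simp: refl_on_def glue_preorder_def intro!: r_into_trancl
      Partial_order_refl[OF PO(2)] Partial_order_refl[OF PO(3)])

lemma glue_preorder_trans: "trans (glue_preorder P Q R f g)"
  by (simp add: glue_preorder_def)

lemmas glue_preorder_facts =
  glue_preorder_refl glue_preorder_trans glue_preorder_carrier

lemma Partial_order_poset_pushout: "Partial_order (poset_pushout P Q R f g)"
  unfolding poset_pushout_def by (rule Partial_order_poset_reflection[OF glue_preorder_facts])

lemma Field_poset_pushout:
  "Field (poset_pushout P Q R f g) =
    iso_class (glue_preorder P Q R f g) ` (Field Q <+> Field R)"
  unfolding poset_pushout_def
  by (rule Field_poset_reflection[OF glue_preorder_refl glue_preorder_carrier])

lemma poset_pushout_inl_hom: "poset_pushout_inl P Q R f g \<in> poset_hom Q (poset_pushout P Q R f g)"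
proof -
  have "(Inl x, Inl x') \<in> glue_preorder P Q R f g" if "(x, x') \<in> Q" for x x'
    unfolding glue_preorder_def by (rule r_into_trancl) (use that in simp)
  then have "(poset_pushout_inl P Q R f g x, poset_pushout_inl P Q R f g x') \<in> poset_pushout P Q R f g"
    if "(x, x') \<in> Q" for x x'
    using that FieldI1[OF that] FieldI2[OF that]
    by (auto simp: poset_pushout_inl_def poset_pushout_def poset_reflection_def)
  moreover have "poset_pushout_inl P Q R f g \<in> Field Q \<rightarrow>\<^sub>E Field (poset_pushout P Q R f g)"
    unfolding Field_poset_pushout by (auto simp: poset_pushout_inl_def)
  ultimately show ?thesis
    unfolding poset_hom_def by blast
qed

lemma poset_pushout_inr_hom: "poset_pushout_inr P Q R f g \<in> poset_hom R (poset_pushout P Q R f g)"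
proof -
  have "(Inr x, Inr x') \<in> glue_preorder P Q R f g" if "(x, x') \<in> R" for x x'
    unfolding glue_preorder_def by (rule r_into_trancl) (use that in simp)
  then have "(poset_pushout_inr P Q R f g x, poset_pushout_inr P Q R f g x') \<in> poset_pushout P Q R f g"
    if "(x, x') \<in> R" for x x'
    using that FieldI1[OF that] FieldI2[OF that]
    by (auto simp: poset_pushout_inr_def poset_pushout_def poset_reflection_def)
  moreover have "poset_pushout_inr P Q R f g \<in> Field R \<rightarrow>\<^sub>E Field (poset_pushout P Q R f g)"
    unfolding Field_poset_pushout by (auto simp: poset_pushout_inr_def)
  ultimately show ?thesis
    unfolding poset_hom_def by blast
qed

lemma poset_pushout_commutes:
  "compose (Field P) (poset_pushout_inl P Q R f g) f =
   compose (Field P) (poset_pushout_inr P Q R f g) g"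
proof
  fix p
  have "iso_class (glue_preorder P Q R f g) (Inl (f p)) =
        iso_class (glue_preorder P Q R f g) (Inr (g p))" if "p \<in> Field P"
  proof -
    have "(Inl (f p), Inr (g p)) \<in> glue_preorder P Q R f g"
        "(Inr (g p), Inl (f p)) \<in> glue_preorder P Q R f g"
      using that unfolding glue_preorder_def by (blast intro: r_into_trancl)+
    then show ?thesis
      using that iso_class_eq_iff[OF glue_preorder_refl glue_preorder_trans]
        poset_hom_mem[OF f] poset_hom_mem[OF g] by (simp add: InlI InrI)
  qed
  then show "compose (Field P) (poset_pushout_inl P Q R f g) f p =
      compose (Field P) (poset_pushout_inr P Q R f g) g p"
    using poset_hom_mem[OF f] poset_hom_mem[OF g]
    by (auto simp: compose_def poset_pushout_inl_def poset_pushout_inr_def)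
qed

theorem poset_pushout_universal:
  fixes S :: "'d rel"
  assumes S: "Partial_order S" and u: "u \<in> poset_hom Q S" and v: "v \<in> poset_hom R S"
    and uv: "compose (Field P) u f = compose (Field P) v g"
  shows "\<exists>!h. h \<in> poset_hom (poset_pushout P Q R f g) S \<and>
              compose (Field Q) h (poset_pushout_inl P Q R f g) = u \<and>
              compose (Field R) h (poset_pushout_inr P Q R f g) = v"
proof -
  let ?G = "glue_preorder P Q R f g" and ?A = "Field Q <+> Field R"
  let ?c = "iso_class ?G" and ?w = "case_sum u v"
  have uvp: "u (f p) = v (g p)" if "p \<in> Field P" for p
    using fun_cong[OF uv, of p] that by (simp add: compose_def)
  have mono: "(?w x, ?w y) \<in> S" if "(x, y) \<in> ?G" for x y
    using that unfolding glue_preorder_def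
  proof (induction rule: trancl_induct)
    case (base y)
    then show ?case
      using uvp Partial_order_refl[OF S] poset_hom_mem[OF v] poset_hom_mem[OF g]
      by (auto dest: poset_hom_mono[OF u] poset_hom_mono[OF v])
  next
    case (step y z)
    have "(?w y, ?w z) \<in> S"
      using step(2) uvp Partial_order_refl[OF S] poset_hom_mem[OF v] poset_hom_mem[OF g]
      by (auto dest: poset_hom_mono[OF u] poset_hom_mono[OF v])
    then show ?case using step(3) Partial_order_trans[OF S] by blast
  qed
  have resp: "?w x = ?w y" if "?c x = ?c y" "x \<in> ?A" "y \<in> ?A" for x y
    using that iso_class_eq_iff[OF glue_preorder_refl glue_preorder_trans that(2,3)]
      mono Partial_order_antisym[OF S] by blast
  have wS: "?w x \<in> Field S" if "x \<in> ?A" for x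
    using that poset_hom_mem[OF v] poset_hom_mem[OF u] by auto
  define h where "h = (\<lambda>C \<in> ?c ` ?A. ?w (inv_into ?A ?c C))"
  have h: "h (?c x) = ?w x" if "x \<in> ?A" for x
  proof -
    have "?c x \<in> ?c ` ?A" using that by blast
    then show ?thesis
      unfolding h_def using resp[OF _ _ that] inv_into_into[of "?c x" ?c ?A] f_inv_into_f[of "?c x" ?c ?A]
      by simp
  qed
  show ?thesis
  proof (rule ex1I[of _ h], intro conjI)
    have "(h C, h D) \<in> S" if "(C, D) \<in> poset_pushout P Q R f g" for C D
    proof -
      obtain x y where *: "C = ?c x" "D = ?c y" "(x, y) \<in> ?G"
        using \<open>(C, D) \<in> _\<close> by (auto simp: poset_pushout_def poset_reflection_def)
      then have "x \<in> ?A" "y \<in> ?A" using glue_preorder_carrier by blast+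
      then show ?thesis using * h mono by simp
    qed
    moreover have "h \<in> ?c ` ?A \<rightarrow>\<^sub>E Field S"
    proof (rule PiE_I)
      fix C assume "C \<in> ?c ` ?A"
      then obtain x where "x \<in> ?A" "C = ?c x" by blast
      then show "h C \<in> Field S" using h wS by metis
    qed (simp add: h_def)
    ultimately show "h \<in> poset_hom (poset_pushout P Q R f g) S"
      unfolding poset_hom_def Field_poset_pushout by auto
    show "compose (Field Q) h (poset_pushout_inl P Q R f g) = u"
      using poset_hom_extensional[OF u] h[OF InlI]
      by (auto simp: compose_def poset_pushout_inl_def extensional_def fun_eq_iff)
    show "compose (Field R) h (poset_pushout_inr P Q R f g) = v"
      using poset_hom_extensional[OF v] h[OF InrI]
      by (auto simp: compose_def poset_pushout_inr_def extensional_def fun_eq_iff)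
  next
    fix k
    assume k: "k \<in> poset_hom (poset_pushout P Q R f g) S \<and>
              compose (Field Q) k (poset_pushout_inl P Q R f g) = u \<and>
              compose (Field R) k (poset_pushout_inr P Q R f g) = v"
    have "k (?c (Inl x)) = u x" if "x \<in> Field Q" for x
      using that k by (auto simp: compose_def poset_pushout_inl_def)
    moreover have "k (?c (Inr x)) = v x" if "x \<in> Field R" for x
      using that k by (auto simp: compose_def poset_pushout_inr_def)
    ultimately have "k C = h C" if "C \<in> ?c ` ?A" for C
      using that h[OF InlI] h[OF InrI] by auto
    moreover have "k \<in> extensional (?c ` ?A)" "h \<in> extensional (?c ` ?A)"
      using poset_hom_extensional[OF conjunct1[OF k]] by (simp_all add: Field_poset_pushout h_def)
    ultimately show "k = h" by (meson extensionalityI)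
  qed
qed

end


subsection \<open>Simplicial sets\<close>

lemma act_mem:
  "simplicial_set X \<Longrightarrow> \<alpha> \<in> Delta_hom m n \<Longrightarrow> x \<in> simplices X n \<Longrightarrow> act X m n \<alpha> x \<in> simplices X m"
  unfolding simplicial_set_def by blast

lemma act_id: "simplicial_set X \<Longrightarrow> x \<in> simplices X n \<Longrightarrow> act X n n (\<lambda>i \<in> {..n}. i) x = x"
  unfolding simplicial_set_def by blast

lemma act_comp:
  "simplicial_set X \<Longrightarrow> \<alpha> \<in> Delta_hom k m \<Longrightarrow> \<beta> \<in> Delta_hom m n \<Longrightarrow> x \<in> simplices X n \<Longrightarrow>
    act X k m \<alpha> (act X m n \<beta> x) = act X k n (compose {..k} \<beta> \<alpha>) x"
  unfolding simplicial_set_def by simp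

lemma sset_hom_mem: "F \<in> sset_hom X Y \<Longrightarrow> x \<in> simplices X n \<Longrightarrow> F n x \<in> simplices Y n"
  unfolding sset_hom_def by blast

lemma sset_hom_act:
  "F \<in> sset_hom X Y \<Longrightarrow> \<alpha> \<in> Delta_hom m n \<Longrightarrow> x \<in> simplices X n \<Longrightarrow>
    F m (act X m n \<alpha> x) = act Y m n \<alpha> (F n x)"
  unfolding sset_hom_def by blast

lemma sset_hom_ext: "F \<in> sset_hom X Y \<Longrightarrow> F n \<in> extensional (simplices X n)"
  unfolding sset_hom_def by (auto simp: PiE_def)

lemma sset_hom_eqI:
  assumes "F \<in> sset_hom X Y" "G \<in> sset_hom X Y'" "\<And>n x. x \<in> simplices X n \<Longrightarrow> F n x = G n x"
  shows "F = G"
proof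
  show "F n = G n" for n
    by (rule extensionalityI[OF sset_hom_ext[OF assms(1)] sset_hom_ext[OF assms(2)] assms(3)])
qed

lemma sset_homI:
  assumes "\<And>n x. x \<in> simplices X n \<Longrightarrow> F n x \<in> simplices Y n"
    "\<And>n. F n \<in> extensional (simplices X n)"
    "\<And>m n \<alpha> x. \<alpha> \<in> Delta_hom m n \<Longrightarrow> x \<in> simplices X n \<Longrightarrow>
      F m (act X m n \<alpha> x) = act Y m n \<alpha> (F n x)"
  shows "F \<in> sset_hom X Y"
  using assms by (auto simp: sset_hom_def PiE_def)

lemma sset_comp_hom:
  assumes "simplicial_set X" "F \<in> sset_hom X Y" "G \<in> sset_hom Y Z"
  shows "sset_comp X G F \<in> sset_hom X Z"
  using assms
  by (intro sset_homI) (auto simp: sset_comp_def compose_def act_mem sset_hom_mem sset_hom_act)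

lemma simplicial_set_nerve: "simplicial_set (nerve P)"
  unfolding simplicial_set_def
proof (intro conjI allI ballI)
  fix m n \<alpha> assume "\<alpha> \<in> Delta_hom m n"
  then show "act (nerve P) m n \<alpha> \<in> simplices (nerve P) n \<rightarrow> simplices (nerve P) m"
    by (auto simp: nerve_def intro: Delta_comp)
next
  fix n x assume "x \<in> simplices (nerve P) n"
  then have "x \<in> extensional {..n}"
    using poset_hom_extensional by (fastforce simp: nerve_def)
  then show "act (nerve P) n n (\<lambda>i \<in> {..n}. i) x = x"
    by (auto simp: nerve_def compose_def extensional_def fun_eq_iff)
next
  fix k m n \<alpha> \<beta> x
  assume "\<alpha> \<in> Delta_hom k m"
  then show "act (nerve P) k n (compose {..k} \<beta> \<alpha>) x =
      act (nerve P) k m \<alpha> (act (nerve P) m n \<beta> x)"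
    by (auto simp: nerve_def compose_def fun_eq_iff dest: Delta_le)
qed

lemma nerve_map_hom:
  assumes "f \<in> poset_hom P R"
  shows "nerve_map P f \<in> sset_hom (nerve P) (nerve R)"
proof (rule sset_homI)
  fix n x assume "x \<in> simplices (nerve P) n"
  then show "nerve_map P f n x \<in> simplices (nerve R) n"
    using poset_hom_comp[of x "ordinal n" P f R] assms by (simp add: nerve_map_def nerve_def)
next
  show "nerve_map P f n \<in> extensional (simplices (nerve P) n)" for n
    by (simp add: nerve_map_def)
next
  fix m n \<alpha> x assume "\<alpha> \<in> Delta_hom m n" "x \<in> simplices (nerve P) n"
  then show "nerve_map P f m (act (nerve P) m n \<alpha> x) = act (nerve R) m n \<alpha> (nerve_map P f n x)"
    using act_mem[OF simplicial_set_nerve, of \<alpha> m n x P]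
    by (auto simp: nerve_map_def nerve_def compose_def fun_eq_iff dest: Delta_le)
qed

lemma nerve_map_comp:
  assumes "f \<in> poset_hom P Q"
  shows "sset_comp (nerve P) (nerve_map Q g) (nerve_map P f) = nerve_map P (compose (Field P) g f)"
proof (intro ext)
  fix n x i
  have "x i \<in> Field P" if "x \<in> simplices (nerve P) n" "i \<le> n"
    using that poset_hom_mem[of x "ordinal n" P i] by (simp add: nerve_def)
  then show "sset_comp (nerve P) (nerve_map Q g) (nerve_map P f) n x i =
      nerve_map P (compose (Field P) g f) n x i"
    using sset_hom_mem[OF nerve_map_hom[OF assms], of x n]
    by (auto simp: sset_comp_def nerve_map_def compose_def)
qed

lemma sset_congruence_equiv: "sset_congruence X E \<Longrightarrow> equiv (simplices X n) (E n)"
  unfolding sset_congruence_def by blast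

lemma sset_congruence_act:
  "sset_congruence X E \<Longrightarrow> \<alpha> \<in> Delta_hom m n \<Longrightarrow> (x, y) \<in> E n \<Longrightarrow>
    (act X m n \<alpha> x, act X m n \<alpha> y) \<in> E m"
  unfolding sset_congruence_def by blast

lemma sset_congruence_class_iff:
  assumes "sset_congruence X E" "x \<in> simplices X n" "y \<in> simplices X n"
  shows "E n `` {x} = E n `` {y} \<longleftrightarrow> (x, y) \<in> E n"
  using sset_congruence_equiv[OF assms(1)] assms(2,3) by (meson eq_equiv_class_iff)

lemma quotient_class_mem: "x \<in> simplices X n \<Longrightarrow> E n `` {x} \<in> simplices (sset_quotient X E) n"
  by (simp add: sset_quotient_def quotientI)

lemma quotient_simplexE:
  assumes "c \<in> simplices (sset_quotient X E) n"
  obtains x where "x \<in> simplices X n" "c = E n `` {x}"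
  using assms by (auto simp: sset_quotient_def elim: quotientE)

lemma act_quotient_class:
  assumes "sset_congruence X E" "\<alpha> \<in> Delta_hom m n" "x \<in> simplices X n"
  shows "act (sset_quotient X E) m n \<alpha> (E n `` {x}) = E m `` {act X m n \<alpha> x}"
proof -
  have e: "equiv (simplices X k) (E k)" for k
    by (rule sset_congruence_equiv[OF assms(1)])
  have xx: "(x, x) \<in> E n" using e assms(3) by (meson equivE refl_onD)
  have cl: "E m `` {act X m n \<alpha> y} = E m `` {act X m n \<alpha> x}" if "(x, y) \<in> E n" for y
    using equiv_class_eq[OF e sset_congruence_act[OF assms(1,2) that]] by (rule sym)
  have "E m `` (act X m n \<alpha> ` (E n `` {x})) = E m `` {act X m n \<alpha> x}"
  proof (intro equalityI subsetI)
    fix z assume "z \<in> E m `` (act X m n \<alpha> ` (E n `` {x}))"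
    then obtain y where y: "(x, y) \<in> E n" "(act X m n \<alpha> y, z) \<in> E m" by (elim ImageE imageE) simp
    from y(2) have "z \<in> E m `` {act X m n \<alpha> y}" by (rule ImageI) simp
    then show "z \<in> E m `` {act X m n \<alpha> x}" unfolding cl[OF y(1)] .
  next
    fix z assume "z \<in> E m `` {act X m n \<alpha> x}"
    then have "(act X m n \<alpha> x, z) \<in> E m" by simp
    moreover have "act X m n \<alpha> x \<in> act X m n \<alpha> ` (E n `` {x})"
      by (rule imageI) (simp add: xx)
    ultimately show "z \<in> E m `` (act X m n \<alpha> ` (E n `` {x}))" by (rule ImageI)
  qed
  then show ?thesis by (simp add: sset_quotient_def)
qed

lemma simplicial_set_quotient:
  assumes X: "simplicial_set X" and E: "sset_congruence X E"
  shows "simplicial_set (sset_quotient X E)"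
  unfolding simplicial_set_def
proof (intro conjI allI ballI)
  fix m n \<alpha> assume \<alpha>: "\<alpha> \<in> Delta_hom m n"
  show "act (sset_quotient X E) m n \<alpha> \<in>
      simplices (sset_quotient X E) n \<rightarrow> simplices (sset_quotient X E) m"
  proof
    fix c assume "c \<in> simplices (sset_quotient X E) n"
    then obtain x where x: "x \<in> simplices X n" "c = E n `` {x}" by (rule quotient_simplexE)
    show "act (sset_quotient X E) m n \<alpha> c \<in> simplices (sset_quotient X E) m"
      using act_quotient_class[OF E \<alpha> x(1)] x quotient_class_mem[OF act_mem[OF X \<alpha> x(1)], of E]
      by simp
  qed
next
  fix n c assume "c \<in> simplices (sset_quotient X E) n"
  then obtain x where x: "x \<in> simplices X n" "c = E n `` {x}" by (rule quotient_simplexE)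
  have "(\<lambda>i \<in> {..n}. i) \<in> Delta_hom n n" by (auto simp: poset_hom_ordinal_iff ordinal_iff)
  then show "act (sset_quotient X E) n n (\<lambda>i \<in> {..n}. i) c = c"
    using x act_quotient_class[OF E] act_id[OF X] by metis
next
  fix k m n \<alpha> \<beta> c
  assume a: "\<alpha> \<in> Delta_hom k m" and b: "\<beta> \<in> Delta_hom m n"
    and "c \<in> simplices (sset_quotient X E) n"
  then obtain x where x: "x \<in> simplices X n" "c = E n `` {x}" by (metis quotient_simplexE)
  show "act (sset_quotient X E) k n (compose {..k} \<beta> \<alpha>) c =
      act (sset_quotient X E) k m \<alpha> (act (sset_quotient X E) m n \<beta> c)"
    by (simp add: x(2) act_quotient_class[OF E] a b x(1) act_mem[OF X] act_comp[OF X]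
        Delta_comp[OF a b])
qed

lemma sset_proj_hom:
  assumes X: "simplicial_set X" and E: "sset_congruence X E"
  shows "sset_proj X E \<in> sset_hom X (sset_quotient X E)"
  by (rule sset_homI)
    (auto simp: sset_proj_def quotient_class_mem act_quotient_class[OF E] act_mem[OF X])

text \<open>A simplicial map out of a quotient is a simplicial map that respects the congruence.\<close>

lemma sset_quotient_universal:
  fixes Y :: "'b sset"
  assumes X: "simplicial_set X" and E: "sset_congruence X E"
    and F: "F \<in> sset_hom X Y" and resp: "\<And>n x y. (x, y) \<in> E n \<Longrightarrow> F n x = F n y"
  shows "\<exists>!h. h \<in> sset_hom (sset_quotient X E) Y \<and> sset_comp X h (sset_proj X E) = F"
proof -
  define h where "h = (\<lambda>n. \<lambda>c \<in> simplices (sset_quotient X E) n. F n (SOME x. x \<in> c))"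
  have h: "h n (E n `` {x}) = F n x" if "x \<in> simplices X n" for n x
  proof -
    have "x \<in> E n `` {x}"
      using sset_congruence_equiv[OF E] that by (meson equiv_class_self)
    then have "(SOME y. y \<in> E n `` {x}) \<in> E n `` {x}" by (rule someI)
    then have "F n x = F n (SOME y. y \<in> E n `` {x})" using resp by simp
    then show ?thesis using quotient_class_mem[OF that, of E] by (simp add: h_def)
  qed
  show ?thesis
  proof (rule ex1I[of _ h], intro conjI)
    show "h \<in> sset_hom (sset_quotient X E) Y"
    proof (rule sset_homI)
      fix n c assume "c \<in> simplices (sset_quotient X E) n"
      then obtain x where "x \<in> simplices X n" "c = E n `` {x}" by (rule quotient_simplexE)
      then show "h n c \<in> simplices Y n" using h sset_hom_mem[OF F] by simp
    next
      show "h n \<in> extensional (simplices (sset_quotient X E) n)" for n by (simp add: h_def)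
    next
      fix m n \<alpha> c assume a: "\<alpha> \<in> Delta_hom m n" and "c \<in> simplices (sset_quotient X E) n"
      then obtain x where x: "x \<in> simplices X n" "c = E n `` {x}" by (metis quotient_simplexE)
      show "h m (act (sset_quotient X E) m n \<alpha> c) = act Y m n \<alpha> (h n c)"
        by (simp add: x act_quotient_class[OF E a] h act_mem[OF X a] sset_hom_act[OF F a])
    qed
    show "sset_comp X h (sset_proj X E) = F"
    proof (intro ext)
      fix n x
      show "sset_comp X h (sset_proj X E) n x = F n x"
        using h[of x n] sset_hom_ext[OF F, of n]
        by (auto simp: sset_comp_def compose_def sset_proj_def extensional_def)
    qed
  next
    fix k assume k: "k \<in> sset_hom (sset_quotient X E) Y \<and> sset_comp X k (sset_proj X E) = F"
    have kx: "k n (E n `` {x}) = F n x" if "x \<in> simplices X n" for n x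
      using fun_cong[OF fun_cong[OF conjunct2[OF k]], of n x] that
      by (simp add: sset_comp_def compose_def sset_proj_def)
    show "k = h"
    proof (intro ext)
      fix n c
      show "k n c = h n c"
      proof (cases "c \<in> simplices (sset_quotient X E) n")
        case True
        then obtain x where "x \<in> simplices X n" "c = E n `` {x}" by (rule quotient_simplexE)
        then show ?thesis using h kx by simp
      next
        case False
        have "k n \<in> extensional (simplices (sset_quotient X E) n)"
          using k sset_hom_ext by blast
        then show ?thesis using False by (simp add: h_def extensional_def)
      qed
    qed
  qed
qed

lemma simplicial_set_coprod:
  assumes X: "simplicial_set X" and Y: "simplicial_set Y"
  shows "simplicial_set (sset_coprod X Y)"
  unfolding simplicial_set_def
  using act_mem[OF X] act_mem[OF Y] act_id[OF X] act_id[OF Y] act_comp[OF X] act_comp[OF Y]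
  by (auto simp: sset_coprod_def)

context
  fixes A :: "'a sset" and X :: "'b sset" and Y :: "'c sset" and f g
  assumes S: "simplicial_set A" "simplicial_set X" "simplicial_set Y"
    and f: "f \<in> sset_hom A X" and g: "g \<in> sset_hom A Y"
begin

lemma glue_rel_congruence: "sset_congruence (sset_coprod X Y) (glue_rel A X Y f g)"
proof -
  let ?C = "sset_coprod X Y"
  define B where "B n = {(Inl (f n a), Inr (g n a)) |a. a \<in> simplices A n} \<union>
     {(Inr (g n a), Inl (f n a)) |a. a \<in> simplices A n}" for n
  have GB: "glue_rel A X Y f g n = (B n)\<^sup>* \<inter> simplices ?C n \<times> simplices ?C n" for n
    by (simp add: glue_rel_def B_def)
  have symB: "sym ((B n)\<^sup>*)" for n
    by (rule sym_rtrancl) (auto simp: B_def sym_def)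
  have step: "(act ?C m n \<alpha> x, act ?C m n \<alpha> y) \<in> B m"
    if "\<alpha> \<in> Delta_hom m n" "(x, y) \<in> B n" for m n \<alpha> x y
    using that act_mem[OF S(1) that(1)]
    by (auto simp: B_def sset_coprod_def sset_hom_act[OF f that(1), symmetric]
        sset_hom_act[OF g that(1), symmetric])
  have steps: "(act ?C m n \<alpha> x, act ?C m n \<alpha> y) \<in> (B m)\<^sup>*"
    if "\<alpha> \<in> Delta_hom m n" "(x, y) \<in> (B n)\<^sup>*" for m n \<alpha> x y
    using that(2)
    by (induction rule: rtrancl_induct)
      (auto intro: rtrancl_into_rtrancl step[OF that(1)])
  show ?thesis
    unfolding sset_congruence_def
  proof (intro conjI allI ballI)
    fix n
    show "equiv (simplices ?C n) (glue_rel A X Y f g n)"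
    proof (rule equivI)
      show "sym (glue_rel A X Y f g n)"
        using symB[of n] by (auto simp: GB sym_def)
      show "trans (glue_rel A X Y f g n)"
        unfolding GB by (rule transI) (auto intro: rtrancl_trans)
    qed (auto simp: GB refl_on_def)
  next
    fix m n \<alpha> p assume a: "\<alpha> \<in> Delta_hom m n" and "p \<in> glue_rel A X Y f g n"
    then show "case p of (x, y) \<Rightarrow> (act ?C m n \<alpha> x, act ?C m n \<alpha> y) \<in> glue_rel A X Y f g m"
      using steps[OF a] act_mem[OF simplicial_set_coprod[OF S(2,3)] a] by (auto simp: GB)
  qed
qed

lemma simplicial_set_pushout: "simplicial_set (sset_pushout A X Y f g)"
  unfolding sset_pushout_def
  by (rule simplicial_set_quotient[OF simplicial_set_coprod[OF S(2,3)] glue_rel_congruence])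

lemma pushout_inl_conv:
  "x \<in> simplices X n \<Longrightarrow>
    sset_pushout_inl A X Y f g n x = sset_proj (sset_coprod X Y) (glue_rel A X Y f g) n (Inl x)"
  by (simp add: sset_pushout_inl_def sset_proj_def sset_coprod_def InlI)

lemma pushout_inr_conv:
  "y \<in> simplices Y n \<Longrightarrow>
    sset_pushout_inr A X Y f g n y = sset_proj (sset_coprod X Y) (glue_rel A X Y f g) n (Inr y)"
  by (simp add: sset_pushout_inr_def sset_proj_def sset_coprod_def InrI)

lemma sset_pushout_inl_hom: "sset_pushout_inl A X Y f g \<in> sset_hom X (sset_pushout A X Y f g)"
proof (rule sset_homI)
  note p = sset_proj_hom[OF simplicial_set_coprod[OF S(2,3)] glue_rel_congruence,
      folded sset_pushout_def]
  { fix n x assume x: "x \<in> simplices X n"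
    then have ix: "Inl x \<in> simplices (sset_coprod X Y) n" by (simp add: sset_coprod_def InlI InrI)
    show "sset_pushout_inl A X Y f g n x \<in> simplices (sset_pushout A X Y f g) n"
      using pushout_inl_conv[OF x] sset_hom_mem[OF p ix] by simp
    fix m \<alpha> assume a: "\<alpha> \<in> Delta_hom m n"
    have "Inl (act X m n \<alpha> x) = act (sset_coprod X Y) m n \<alpha> (Inl x)"
      by (simp add: sset_coprod_def)
    then show "sset_pushout_inl A X Y f g m (act X m n \<alpha> x) =
        act (sset_pushout A X Y f g) m n \<alpha> (sset_pushout_inl A X Y f g n x)"
      using pushout_inl_conv[OF x] pushout_inl_conv[OF act_mem[OF S(2) a x]]
        sset_hom_act[OF p a ix] by simp }
qed (simp add: sset_pushout_inl_def)

lemma sset_pushout_inr_hom: "sset_pushout_inr A X Y f g \<in> sset_hom Y (sset_pushout A X Y f g)"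
proof (rule sset_homI)
  note p = sset_proj_hom[OF simplicial_set_coprod[OF S(2,3)] glue_rel_congruence,
      folded sset_pushout_def]
  { fix n x assume x: "x \<in> simplices Y n"
    then have ix: "Inr x \<in> simplices (sset_coprod X Y) n" by (simp add: sset_coprod_def InlI InrI)
    show "sset_pushout_inr A X Y f g n x \<in> simplices (sset_pushout A X Y f g) n"
      using pushout_inr_conv[OF x] sset_hom_mem[OF p ix] by simp
    fix m \<alpha> assume a: "\<alpha> \<in> Delta_hom m n"
    have "Inr (act Y m n \<alpha> x) = act (sset_coprod X Y) m n \<alpha> (Inr x)"
      by (simp add: sset_coprod_def)
    then show "sset_pushout_inr A X Y f g m (act Y m n \<alpha> x) =
        act (sset_pushout A X Y f g) m n \<alpha> (sset_pushout_inr A X Y f g n x)"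
      using pushout_inr_conv[OF x] pushout_inr_conv[OF act_mem[OF S(3) a x]]
        sset_hom_act[OF p a ix] by simp }
qed (simp add: sset_pushout_inr_def)

lemma sset_pushout_commutes:
  "sset_comp A (sset_pushout_inl A X Y f g) f = sset_comp A (sset_pushout_inr A X Y f g) g"
proof (intro ext)
  fix n a
  have "glue_rel A X Y f g n `` {Inl (f n a)} = glue_rel A X Y f g n `` {Inr (g n a)}"
    if a: "a \<in> simplices A n"
  proof -
    have "Inl (f n a) \<in> simplices (sset_coprod X Y) n" "Inr (g n a) \<in> simplices (sset_coprod X Y) n"
      using sset_hom_mem[OF f a] sset_hom_mem[OF g a] by (auto simp: sset_coprod_def)
    then have "(Inl (f n a), Inr (g n a)) \<in> glue_rel A X Y f g n"
      using a by (auto simp: glue_rel_def intro!: r_into_rtrancl)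
    then show ?thesis
      by (rule equiv_class_eq[OF sset_congruence_equiv[OF glue_rel_congruence]])
  qed
  then show "sset_comp A (sset_pushout_inl A X Y f g) f n a =
      sset_comp A (sset_pushout_inr A X Y f g) g n a"
    using sset_hom_mem[OF f] sset_hom_mem[OF g]
    by (auto simp: sset_comp_def compose_def sset_pushout_inl_def sset_pushout_inr_def)
qed

theorem sset_pushout_universal:
  fixes Z :: "'d sset"
  assumes u: "u \<in> sset_hom X Z" and v: "v \<in> sset_hom Y Z"
    and uv: "sset_comp A u f = sset_comp A v g"
  shows "\<exists>!h. h \<in> sset_hom (sset_pushout A X Y f g) Z \<and>
              sset_comp X h (sset_pushout_inl A X Y f g) = u \<and>
              sset_comp Y h (sset_pushout_inr A X Y f g) = v"
proof -
  let ?C = "sset_coprod X Y" and ?E = "glue_rel A X Y f g"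
  define w where "w = (\<lambda>n. \<lambda>z \<in> simplices ?C n. case_sum (u n) (v n) z)"
  have w: "w \<in> sset_hom ?C Z"
    by (rule sset_homI)
      (auto simp: w_def sset_coprod_def sset_hom_mem[OF u] sset_hom_mem[OF v]
        sset_hom_act[OF u] sset_hom_act[OF v] act_mem[OF S(2)] act_mem[OF S(3)])
  have uvp: "u n (f n a) = v n (g n a)" if "a \<in> simplices A n" for n a
    using fun_cong[OF fun_cong[OF uv], of n a] that by (simp add: sset_comp_def compose_def)
  have resp: "w n x = w n y" if "(x, y) \<in> ?E n" for n x y
  proof -
    have "(x, y) \<in> ({(Inl (f n a), Inr (g n a)) |a. a \<in> simplices A n} \<union>
        {(Inr (g n a), Inl (f n a)) |a. a \<in> simplices A n})\<^sup>*"
      using that by (simp add: glue_rel_def)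
    then have "case_sum (u n) (v n) x = case_sum (u n) (v n) y"
      by (induction rule: rtrancl_induct) (auto simp: uvp)
    then show ?thesis using that by (auto simp: w_def glue_rel_def)
  qed
  have eq: "sset_comp ?C h (sset_proj ?C ?E) = w \<longleftrightarrow>
      sset_comp X h (sset_pushout_inl A X Y f g) = u \<and>
      sset_comp Y h (sset_pushout_inr A X Y f g) = v" for h
  proof -
    have "sset_comp ?C h (sset_proj ?C ?E) = w \<longleftrightarrow>
        (\<forall>n. \<forall>z \<in> simplices ?C n. h n (?E n `` {z}) = case_sum (u n) (v n) z)"
      by (auto simp: sset_comp_def compose_def sset_proj_def w_def fun_eq_iff)
    also have "\<dots> \<longleftrightarrow> (\<forall>n. \<forall>x \<in> simplices X n. h n (?E n `` {Inl x}) = u n x) \<and>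
        (\<forall>n. \<forall>x \<in> simplices Y n. h n (?E n `` {Inr x}) = v n x)"
      by (simp add: sset_coprod_def Plus_def ball_Un all_conj_distrib)
    also have "(\<forall>n. \<forall>x \<in> simplices X n. h n (?E n `` {Inl x}) = u n x) \<longleftrightarrow>
        sset_comp X h (sset_pushout_inl A X Y f g) = u"
      using sset_hom_ext[OF u]
      by (auto simp: sset_comp_def compose_def sset_pushout_inl_def fun_eq_iff extensional_def
          restrict_def)
    also have "(\<forall>n. \<forall>x \<in> simplices Y n. h n (?E n `` {Inr x}) = v n x) \<longleftrightarrow>
        sset_comp Y h (sset_pushout_inr A X Y f g) = v"
      using sset_hom_ext[OF v]
      by (auto simp: sset_comp_def compose_def sset_pushout_inr_def fun_eq_iff extensional_def
          restrict_def)
    finally show ?thesis .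
  qed
  show ?thesis
    using sset_quotient_universal[OF simplicial_set_coprod[OF S(2,3)] glue_rel_congruence w resp]
    unfolding eq sset_pushout_def[symmetric] by blast
qed

end


subsection \<open>Desingularization\<close>

text \<open>\<open>collapse n j\<close> is the idempotent of \<open>[n]\<close> that sends \<open>j + 1\<close> to \<open>j\<close> and fixes the rest.\<close>

definition collapse :: "nat \<Rightarrow> nat \<Rightarrow> nat \<Rightarrow> nat" where
  "collapse n j = (\<lambda>k \<in> {..n}. if k = Suc j then j else k)"

lemma collapse_hom: "collapse n j \<in> Delta_hom n n"
  by (auto simp: poset_hom_ordinal_iff collapse_def ordinal_iff)

lemma collapse_fixed_degenerate:
  assumes X: "simplicial_set X" and x: "x \<in> simplices X n" and j: "j < n"
    and fix_x: "act X n n (collapse n j) x = x"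
  shows "degenerate X n x"
proof -
  define \<sigma> where "\<sigma> = (\<lambda>k \<in> {..n}. if k \<le> j then k else k - 1)"
  define \<delta> where "\<delta> = (\<lambda>k \<in> {..n - 1}. if k \<le> j then k else Suc k)"
  have s: "\<sigma> \<in> Delta_hom n (n - 1)"
    using j by (auto simp: poset_hom_ordinal_iff \<sigma>_def ordinal_iff)
  have d: "\<delta> \<in> Delta_hom (n - 1) n"
    using j by (auto simp: poset_hom_ordinal_iff \<delta>_def ordinal_iff)
  have "compose {..n} \<delta> \<sigma> = collapse n j"
    using j by (auto simp: compose_def \<delta>_def \<sigma>_def collapse_def fun_eq_iff)
  then have "x = act X n (n - 1) \<sigma> (act X (n - 1) n \<delta> x)"
    using act_comp[OF X s d x] fix_x by simp
  moreover have "\<sigma> ` {..n} = {..n - 1}"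
  proof
    show "\<sigma> ` {..n} \<subseteq> {..n - 1}" using Delta_le[OF s] by auto
    show "{..n - 1} \<subseteq> \<sigma> ` {..n}"
    proof
      fix k assume "k \<in> {..n - 1}"
      then have "k = \<sigma> (if k \<le> j then k else Suc k)" "(if k \<le> j then k else Suc k) \<in> {..n}"
        using j by (auto simp: \<sigma>_def)
      then show "k \<in> \<sigma> ` {..n}" by blast
    qed
  qed
  moreover have "n - 1 < n" using j by simp
  ultimately show ?thesis
    unfolding degenerate_def using s act_mem[OF X d x] by blast
qed

lemma nondegenerate_root:
  assumes X: "simplicial_set X" and "x \<in> simplices X n"
  shows "\<exists>m. \<exists>\<sigma> \<in> Delta_hom n m. \<exists>y \<in> simplices X m. \<not> degenerate X m y \<and> x = act X n m \<sigma> y"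
  using assms(2)
proof (induction n arbitrary: x rule: less_induct)
  case (less n)
  show ?case
  proof (cases "degenerate X n x")
    case True
    then obtain m \<sigma> y where 1: "m < n" "\<sigma> \<in> Delta_hom n m" "y \<in> simplices X m" "x = act X n m \<sigma> y"
      unfolding degenerate_def by blast
    obtain k \<tau> z where 2: "\<tau> \<in> Delta_hom m k" "z \<in> simplices X k" "\<not> degenerate X k z"
        "y = act X m k \<tau> z"
      using less.IH[OF 1(1,3)] by blast
    have "x = act X n k (compose {..n} \<tau> \<sigma>) z"
      using 1 2 act_comp[OF X] by simp
    then show ?thesis using 2 Delta_comp[OF 1(2) 2(1)] by blast
  next
    case False
    have "(\<lambda>i \<in> {..n}. i) \<in> Delta_hom n n" by (auto simp: poset_hom_ordinal_iff ordinal_iff)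
    then show ?thesis using False less.prems act_id[OF X less.prems] by metis
  qed
qed

lemma nonsingular_collapse:
  assumes X: "simplicial_set X" "nonsingular X" and x: "x \<in> simplices X n"
    and ab: "\<alpha> \<in> Delta_hom m n" "\<beta> \<in> Delta_hom m n" "act X m n \<alpha> x = act X m n \<beta> x"
    and i: "i \<le> m" "\<alpha> i < \<beta> i"
  shows "act X n n (collapse n (\<alpha> i)) x = x"
proof -
  obtain k \<sigma> y where y: "\<sigma> \<in> Delta_hom n k" "y \<in> simplices X k" "\<not> degenerate X k y"
      "x = act X n k \<sigma> y"
    using nondegenerate_root[OF X(1) x] by blast
  have "inj_on (representing_map X k y m) (Delta_hom m k)"
    using X(2) y(2,3) unfolding nonsingular_def by (auto simp: nerve_def)
  moreover have "representing_map X k y m (compose {..m} \<sigma> \<alpha>) =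
      representing_map X k y m (compose {..m} \<sigma> \<beta>)"
    using ab y act_comp[OF X(1)] Delta_comp[OF ab(1) y(1)] Delta_comp[OF ab(2) y(1)]
    by (simp add: representing_map_def nerve_def)
  ultimately have "compose {..m} \<sigma> \<alpha> = compose {..m} \<sigma> \<beta>"
    using Delta_comp[OF ab(1) y(1)] Delta_comp[OF ab(2) y(1)] by (simp add: inj_on_def)
  then have "compose {..m} \<sigma> \<alpha> i = compose {..m} \<sigma> \<beta> i" by simp
  then have eq: "\<sigma> (\<alpha> i) = \<sigma> (\<beta> i)"
    using i by (simp add: compose_def)
  have bn: "\<beta> i \<le> n" using Delta_le[OF ab(2) i(1)] .
  have "\<sigma> (\<alpha> i) \<le> \<sigma> (Suc (\<alpha> i))" "\<sigma> (Suc (\<alpha> i)) \<le> \<sigma> (\<beta> i)"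
    using Delta_mono[OF y(1)] i bn by auto
  then have "\<sigma> (Suc (\<alpha> i)) = \<sigma> (\<alpha> i)" using eq by simp
  moreover have "\<sigma> \<in> extensional {..n}"
    using poset_hom_extensional[OF y(1)] by simp
  ultimately have "compose {..n} \<sigma> (collapse n (\<alpha> i)) = \<sigma>"
    by (auto simp: compose_def collapse_def fun_eq_iff extensional_def)
  then show ?thesis
    using act_comp[OF X(1) collapse_hom y(1,2)] y(4) by simp
qed

lemma nonsingularI:
  assumes X: "simplicial_set X"
    and coll: "\<And>m n x \<alpha> \<beta> i. x \<in> simplices X n \<Longrightarrow> \<alpha> \<in> Delta_hom m n \<Longrightarrow> \<beta> \<in> Delta_hom m n \<Longrightarrow>
      act X m n \<alpha> x = act X m n \<beta> x \<Longrightarrow> i \<le> m \<Longrightarrow> \<alpha> i < \<beta> i \<Longrightarrow>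
      act X n n (collapse n (\<alpha> i)) x = x"
  shows "nonsingular X"
  unfolding nonsingular_def
proof (intro allI ballI impI)
  fix n x m assume x: "x \<in> simplices X n" "\<not> degenerate X n x"
  have no: False if ab: "\<alpha> \<in> Delta_hom m n" "\<beta> \<in> Delta_hom m n"
      "act X m n \<alpha> x = act X m n \<beta> x" and i: "i \<le> m" "\<alpha> i < \<beta> i" for \<alpha> \<beta> i
  proof -
    have "\<alpha> i < n" using i Delta_le[OF ab(2) i(1)] by simp
    then show False
      using collapse_fixed_degenerate[OF X x(1) _ coll[OF x(1) ab i]] x(2) by blast
  qed
  show "inj_on (representing_map X n x m) (simplices (std_simplex n) m)"
  proof (rule inj_onI)
    fix \<alpha> \<beta> assume "\<alpha> \<in> simplices (std_simplex n) m" "\<beta> \<in> simplices (std_simplex n) m"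
      "representing_map X n x m \<alpha> = representing_map X n x m \<beta>"
    then have ab: "\<alpha> \<in> Delta_hom m n" "\<beta> \<in> Delta_hom m n" "act X m n \<alpha> x = act X m n \<beta> x"
      by (auto simp: nerve_def representing_map_def)
    show "\<alpha> = \<beta>"
    proof (rule extensionalityI)
      show "\<alpha> \<in> extensional {..m}" "\<beta> \<in> extensional {..m}"
        using poset_hom_extensional[OF ab(1)] poset_hom_extensional[OF ab(2)] by simp_all
      fix i assume "i \<in> {..m}"
      then show "\<alpha> i = \<beta> i"
        using no[OF ab] no[OF ab(2,1) ab(3)[symmetric]] by (metis atMost_iff nat_neq_iff)
    qed
  qed
qed

lemma nonsingular_nerve:
  assumes P: "Partial_order P"
  shows "nonsingular (nerve P)"
proof (rule nonsingularI[OF simplicial_set_nerve])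
  fix m n x \<alpha> \<beta> i
  assume "x \<in> simplices (nerve P) n" and ab: "\<alpha> \<in> Delta_hom m n" "\<beta> \<in> Delta_hom m n"
    "act (nerve P) m n \<alpha> x = act (nerve P) m n \<beta> x" and i: "i \<le> m" "\<alpha> i < \<beta> i"
  then have x: "x \<in> poset_hom (ordinal n) P" by (simp add: nerve_def)
  have bn: "\<beta> i \<le> n" using Delta_le[OF ab(2) i(1)] .
  have "x (\<alpha> i) = x (\<beta> i)"
    using fun_cong[OF ab(3), of i] i by (simp add: nerve_def compose_def)
  moreover have "(x (\<alpha> i), x (Suc (\<alpha> i))) \<in> P" "(x (Suc (\<alpha> i)), x (\<beta> i)) \<in> P"
    using x i bn by (auto simp: poset_hom_ordinal_iff)
  ultimately have "x (Suc (\<alpha> i)) = x (\<alpha> i)"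
    using Partial_order_antisym[OF P] by metis
  then show "act (nerve P) n n (collapse n (\<alpha> i)) x = x"
    using poset_hom_extensional[OF x]
    by (auto simp: nerve_def compose_def collapse_def fun_eq_iff extensional_def)
qed

lemma nonsingular_quotientI:
  assumes X: "simplicial_set X" and E: "sset_congruence X E"
    and coll: "\<And>m n x \<alpha> \<beta> i. x \<in> simplices X n \<Longrightarrow> \<alpha> \<in> Delta_hom m n \<Longrightarrow> \<beta> \<in> Delta_hom m n \<Longrightarrow>
      (act X m n \<alpha> x, act X m n \<beta> x) \<in> E m \<Longrightarrow> i \<le> m \<Longrightarrow> \<alpha> i < \<beta> i \<Longrightarrow>
      (act X n n (collapse n (\<alpha> i)) x, x) \<in> E n"
  shows "nonsingular (sset_quotient X E)"
proof (rule nonsingularI[OF simplicial_set_quotient[OF X E]])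
  fix m n c \<alpha> \<beta> i
  assume "c \<in> simplices (sset_quotient X E) n" and a: "\<alpha> \<in> Delta_hom m n" and b: "\<beta> \<in> Delta_hom m n"
    and eq: "act (sset_quotient X E) m n \<alpha> c = act (sset_quotient X E) m n \<beta> c"
    and i: "i \<le> m" "\<alpha> i < \<beta> i"
  then obtain x where x: "x \<in> simplices X n" "c = E n `` {x}" by (metis quotient_simplexE)
  have "(act X m n \<alpha> x, act X m n \<beta> x) \<in> E m"
    using eq x act_quotient_class[OF E] a b act_mem[OF X]
    by (simp add: sset_congruence_class_iff[OF E])
  from coll[OF x(1) a b this i] show "act (sset_quotient X E) n n (collapse n (\<alpha> i)) c = c"
    using x act_quotient_class[OF E collapse_hom] act_mem[OF X collapse_hom]
    by (simp add: sset_congruence_class_iff[OF E])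
qed

lemma nonsingular_quotientD:
  assumes X: "simplicial_set X" and E: "sset_congruence X E" and N: "nonsingular (sset_quotient X E)"
    and x: "x \<in> simplices X n" and a: "\<alpha> \<in> Delta_hom m n" and b: "\<beta> \<in> Delta_hom m n"
    and eq: "(act X m n \<alpha> x, act X m n \<beta> x) \<in> E m" and i: "i \<le> m" "\<alpha> i < \<beta> i"
  shows "(act X n n (collapse n (\<alpha> i)) x, x) \<in> E n"
proof -
  have "act (sset_quotient X E) n n (collapse n (\<alpha> i)) (E n `` {x}) = E n `` {x}"
  proof (rule nonsingular_collapse[OF simplicial_set_quotient[OF X E] N _ a b _ i])
    show "E n `` {x} \<in> simplices (sset_quotient X E) n" by (rule quotient_class_mem[OF x])
    show "act (sset_quotient X E) m n \<alpha> (E n `` {x}) = act (sset_quotient X E) m n \<beta> (E n `` {x})"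
      using eq x a b act_quotient_class[OF E] act_mem[OF X]
      by (simp add: sset_congruence_class_iff[OF E])
  qed
  then show ?thesis
    using x act_quotient_class[OF E collapse_hom] act_mem[OF X collapse_hom]
    by (simp add: sset_congruence_class_iff[OF E])
qed

context
  fixes X :: "'a sset"
  assumes X: "simplicial_set X"
begin

lemma desing_rel_congruence: "sset_congruence X (desing_rel X)"
  unfolding sset_congruence_def
proof (intro conjI allI ballI)
  fix n
  have E: "refl_on (simplices X n) (E n)" "sym (E n)" "trans (E n)" if "sset_congruence X E" for E
    using sset_congruence_equiv[OF that, of n] by (auto simp: equiv_def)
  show "equiv (simplices X n) (desing_rel X n)"
  proof (rule equivI)
    show "refl_on (simplices X n) (desing_rel X n)"
      using E(1) by (auto simp: desing_rel_def refl_on_def)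
    show "sym (desing_rel X n)"
      using E(2) by (auto simp: desing_rel_def sym_def)
    show "trans (desing_rel X n)"
    proof (rule transI)
      fix x y z assume "(x, y) \<in> desing_rel X n" "(y, z) \<in> desing_rel X n"
      then show "(x, z) \<in> desing_rel X n"
        using E(3) unfolding desing_rel_def by (auto dest: transD)
    qed
  qed (auto simp: desing_rel_def)
next
  fix m n \<alpha> p assume a: "\<alpha> \<in> Delta_hom m n" and "p \<in> desing_rel X n"
  moreover have "(act X m n \<alpha> x, act X m n \<alpha> y) \<in> E m"
    if "sset_congruence X E" "(x, y) \<in> E n" for E x y
    by (rule sset_congruence_act[OF that(1) a that(2)])
  ultimately show "case p of (x, y) \<Rightarrow> (act X m n \<alpha> x, act X m n \<alpha> y) \<in> desing_rel X m"
    using act_mem[OF X a] by (auto simp: desing_rel_def)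
qed

lemma simplicial_set_desing: "simplicial_set (desing X)"
  unfolding desing_def by (rule simplicial_set_quotient[OF X desing_rel_congruence])

theorem nonsingular_desing: "nonsingular (desing X)"
  unfolding desing_def
proof (rule nonsingular_quotientI[OF X desing_rel_congruence])
  fix m n x \<alpha> \<beta> i
  assume x: "x \<in> simplices X n" and a: "\<alpha> \<in> Delta_hom m n" and b: "\<beta> \<in> Delta_hom m n"
    and eq: "(act X m n \<alpha> x, act X m n \<beta> x) \<in> desing_rel X m" and i: "i \<le> m" "\<alpha> i < \<beta> i"
  show "(act X n n (collapse n (\<alpha> i)) x, x) \<in> desing_rel X n"
    using eq x act_mem[OF X collapse_hom x] nonsingular_quotientD[OF X _ _ x a b _ i]
    by (auto simp: desing_rel_def)
qed

lemma desing_unit_hom: "desing_unit X \<in> sset_hom X (desing X)"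
  unfolding desing_unit_def desing_def by (rule sset_proj_hom[OF X desing_rel_congruence])

theorem desing_universal:
  fixes Y :: "'b sset"
  assumes Y: "simplicial_set Y" "nonsingular Y" and f: "f \<in> sset_hom X Y"
  shows "\<exists>!h. h \<in> sset_hom (desing X) Y \<and> sset_comp X h (desing_unit X) = f"
  unfolding desing_def desing_unit_def
proof (rule sset_quotient_universal[OF X desing_rel_congruence f])
  define K where "K n = {(x, y) \<in> simplices X n \<times> simplices X n. f n x = f n y}" for n
  have K: "sset_congruence X K"
    unfolding sset_congruence_def
  proof (intro conjI allI ballI)
    show "equiv (simplices X n) (K n)" for n
      by (rule equivI) (auto simp: K_def refl_on_def sym_def trans_def)
    fix m n \<alpha> p assume "\<alpha> \<in> Delta_hom m n" "p \<in> K n"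
    then show "case p of (x, y) \<Rightarrow> (act X m n \<alpha> x, act X m n \<alpha> y) \<in> K m"
      using act_mem[OF X] sset_hom_act[OF f] by (auto simp: K_def)
  qed
  have "nonsingular (sset_quotient X K)"
  proof (rule nonsingular_quotientI[OF X K])
    fix m n x \<alpha> \<beta> i
    assume x: "x \<in> simplices X n" and a: "\<alpha> \<in> Delta_hom m n" and b: "\<beta> \<in> Delta_hom m n"
      and eq: "(act X m n \<alpha> x, act X m n \<beta> x) \<in> K m" and i: "i \<le> m" "\<alpha> i < \<beta> i"
    have "act Y m n \<alpha> (f n x) = act Y m n \<beta> (f n x)"
      using eq x a b sset_hom_act[OF f] by (simp add: K_def)
    from nonsingular_collapse[OF Y sset_hom_mem[OF f x] a b this i]
    show "(act X n n (collapse n (\<alpha> i)) x, x) \<in> K n"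
      using x act_mem[OF X collapse_hom x] sset_hom_act[OF f collapse_hom x] by (simp add: K_def)
  qed
  then have N: "sset_congruence X K \<and> nonsingular (sset_quotient X K)"
    using K by blast
  fix n x y
  assume "(x, y) \<in> desing_rel X n"
  then have "\<forall>E. sset_congruence X E \<and> nonsingular (sset_quotient X E) \<longrightarrow> (x, y) \<in> E n"
    by (simp add: desing_rel_def)
  from mp[OF spec[OF this, of K] N] have "(x, y) \<in> K n" .
  then show "f n x = f n y" by (simp add: K_def)
qed

end


subsection \<open>The cylinder reduction map\<close>

context
  fixes P :: "'a rel" and R :: "'b rel" and \<phi>
  assumes PR: "Partial_order P" "Partial_order R" and \<phi>: "\<phi> \<in> poset_hom P R"
begin

private lemmas cyl_facts =
  PR(1) Partial_order_prod[OF PR(1) Partial_order_ordinal[of 1]] PR(2) cyl_i0_hom[OF PR(1)] \<phi>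

lemma simplicial_set_top_cyl: "simplicial_set (top_cyl P R \<phi>)"
  unfolding top_cyl_def
  by (intro simplicial_set_pushout simplicial_set_nerve nerve_map_hom cyl_facts)

lemma simplicial_set_red_cyl: "simplicial_set (red_cyl P R \<phi>)"
  unfolding red_cyl_def by (rule simplicial_set_nerve)

lemma nonsingular_red_cyl: "nonsingular (red_cyl P R \<phi>)"
  unfolding red_cyl_def
  by (intro nonsingular_nerve Partial_order_poset_pushout cyl_facts)

lemma cr_spec:
  "cr P R \<phi> \<in> sset_hom (top_cyl P R \<phi>) (red_cyl P R \<phi>) \<and>
   sset_comp (nerve (poset_prod P (ordinal 1))) (cr P R \<phi>)
     (sset_pushout_inl (nerve P) (nerve (poset_prod P (ordinal 1))) (nerve R)
       (nerve_map P (cyl_i0 P)) (nerve_map P \<phi>)) =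
   nerve_map (poset_prod P (ordinal 1))
     (poset_pushout_inl P (poset_prod P (ordinal 1)) R (cyl_i0 P) \<phi>) \<and>
   sset_comp (nerve R) (cr P R \<phi>)
     (sset_pushout_inr (nerve P) (nerve (poset_prod P (ordinal 1))) (nerve R)
       (nerve_map P (cyl_i0 P)) (nerve_map P \<phi>)) =
   nerve_map R (poset_pushout_inr P (poset_prod P (ordinal 1)) R (cyl_i0 P) \<phi>)"
proof -
  have comm: "sset_comp (nerve P) (nerve_map (poset_prod P (ordinal 1))
        (poset_pushout_inl P (poset_prod P (ordinal 1)) R (cyl_i0 P) \<phi>)) (nerve_map P (cyl_i0 P)) =
      sset_comp (nerve P) (nerve_map R
        (poset_pushout_inr P (poset_prod P (ordinal 1)) R (cyl_i0 P) \<phi>)) (nerve_map P \<phi>)"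
    unfolding nerve_map_comp[OF cyl_i0_hom[OF PR(1)]] nerve_map_comp[OF \<phi>]
      poset_pushout_commutes[OF cyl_facts] ..
  show ?thesis
    using theI'[OF sset_pushout_universal[OF simplicial_set_nerve simplicial_set_nerve
          simplicial_set_nerve nerve_map_hom[OF cyl_i0_hom[OF PR(1)]] nerve_map_hom[OF \<phi>]
          nerve_map_hom[OF poset_pushout_inl_hom[OF cyl_facts]]
          nerve_map_hom[OF poset_pushout_inr_hom[OF cyl_facts]] comm]]
    unfolding cr_def sset_pushout_map_def top_cyl_def red_cyl_def .
qed

lemma dcr_spec:
  "dcr P R \<phi> \<in> sset_hom (desing (top_cyl P R \<phi>)) (red_cyl P R \<phi>) \<and>
   sset_comp (top_cyl P R \<phi>) (dcr P R \<phi>) (desing_unit (top_cyl P R \<phi>)) = cr P R \<phi>"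
  unfolding dcr_def desing_factor_def
  by (rule theI'[OF desing_universal[OF simplicial_set_top_cyl simplicial_set_red_cyl
          nonsingular_red_cyl cr_spec[THEN conjunct1]]])

end

end

theory Submission
  imports Defs
begin

text \<open>
  In a non-singular simplicial set a simplex is a degeneration of one with pairwise distinct
  vertices, so two of its faces agree as soon as their vertices agree. Now let \<open>x\<close> be a simplex of
  the cone on \<open>N P\<close> whose first \<open>k\<close> vertices lie at the apex and whose first remaining vertex is
  \<open>(p, 1)\<close>. Inserting \<open>(p, 0)\<close> before \<open>(p, 1)\<close> gives a simplex whose first \<open>k + 1\<close> vertices
  are all the apex. Hence, after desingularization, \<open>x\<close> equals the simplex obtained by replacing
  each of its first \<open>k\<close> vertices by \<open>(p, 0)\<close>. This simplex depends only on the image of \<open>x\<close> in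
  the reduced cylinder, which is the nerve of \<open>P\<close> with a bottom element adjoined.
\<close>

section \<open>Simplicial sets\<close>

text \<open>The degreewise inverse is automatically simplicial: \<open>F\<close> commutes with the
  operators, and \<open>G\<close> can be cancelled against it on both sides.\<close>

lemma sset_iso_if_bij_betw:
  assumes X: "simplicial_set X" and F: "F \<in> sset_hom X Y"
    and bij: "\<And>n. bij_betw (F n) (simplices X n) (simplices Y n)"
  shows "sset_iso X Y F"
proof -
  define G where "G = (\<lambda>n. \<lambda>y \<in> simplices Y n. inv_into (simplices X n) (F n) y)"
  have GF: "G n (F n x) = x" if "x \<in> simplices X n" for n x
    using sset_hom_mem[OF F that] bij_betw_inv_into_left[OF bij that] by (simp add: G_def)
  have FG: "F n (G n y) = y" if "y \<in> simplices Y n" for n y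
    using that bij_betw_inv_into_right[OF bij that] by (simp add: G_def)
  have Gm: "G n y \<in> simplices X n" if "y \<in> simplices Y n" for n y
    using that bij_betw_apply[OF bij_betw_inv_into[OF bij]] by (simp add: G_def)
  have "G \<in> sset_hom Y X"
  proof (rule sset_homI[OF Gm])
    show "G n \<in> extensional (simplices Y n)" for n by (simp add: G_def)
    fix m n \<alpha> y assume a: "\<alpha> \<in> Delta_hom m n" and y: "y \<in> simplices Y n"
    have "F m (act X m n \<alpha> (G n y)) = act Y m n \<alpha> y"
      using sset_hom_act[OF F a Gm[OF y]] FG[OF y] by simp
    then show "G m (act Y m n \<alpha> y) = act X m n \<alpha> (G n y)"
      using GF[OF act_mem[OF X a Gm[OF y]]] by simp
  qed
  moreover have "sset_comp X G F = sset_id X" "sset_comp Y F G = sset_id Y"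
    using GF FG by (auto simp: sset_comp_def sset_id_def compose_def fun_eq_iff)
  ultimately show ?thesis using F by (auto simp: sset_iso_def)
qed

text \<open>The operator that picks out vertex \<open>i\<close> of a simplex. It is restricted to
  \<open>{..0}\<close> because elements of \<open>Delta_hom 0 n\<close> are extensional; one
  function serves every \<open>n\<close> with \<open>i \<le> n\<close>.\<close>

definition vertex :: "nat \<Rightarrow> nat \<Rightarrow> nat" where
  "vertex i = (\<lambda>j \<in> {..0}. i)"

lemma vertex_hom: "i \<le> n \<Longrightarrow> vertex i \<in> Delta_hom 0 n"
  by (auto simp: vertex_def poset_hom_ordinal_iff ordinal_iff)

lemma compose_vertex: "compose {0} f (vertex i) = vertex (f i)"
  by (auto simp: compose_def vertex_def)

lemma nonsingular_act_eqI:
  assumes X: "simplicial_set X" "nonsingular X" and x: "x \<in> simplices X n"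
    and ab: "\<alpha> \<in> Delta_hom m n" "\<beta> \<in> Delta_hom m n"
    and eq: "\<And>i. i \<le> m \<Longrightarrow> act X 0 n (vertex (\<alpha> i)) x = act X 0 n (vertex (\<beta> i)) x"
  shows "act X m n \<alpha> x = act X m n \<beta> x"
proof -
  obtain k \<sigma> y where y: "\<sigma> \<in> Delta_hom n k" "y \<in> simplices X k" "\<not> degenerate X k y"
      "x = act X n k \<sigma> y"
    using nondegenerate_root[OF X(1) x] by blast
  \<comment> \<open>In degree 0, injectivity says that the vertices of \<open>y\<close> are pairwise
    distinct, so a vertex of \<open>x\<close> determines the value of \<sigma> on its index.\<close>
  have inj: "inj_on (representing_map X k y 0) (Delta_hom 0 k)"
    using X(2) y(2,3) unfolding nonsingular_def by (auto simp: nerve_def)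
  have "\<sigma> (\<alpha> i) = \<sigma> (\<beta> i)" if i: "i \<le> m" for i
  proof -
    have le: "\<alpha> i \<le> n" "\<beta> i \<le> n"
      using Delta_le[OF ab(1) i] Delta_le[OF ab(2) i] by auto
    then have "\<sigma> (\<alpha> i) \<le> k" "\<sigma> (\<beta> i) \<le> k"
      using Delta_le[OF y(1)] by auto
    note vertices = vertex_hom[OF this(1)] vertex_hom[OF this(2)]
    have "act X 0 k (vertex (\<sigma> (\<alpha> i))) y = act X 0 k (vertex (\<sigma> (\<beta> i))) y"
      using eq[OF i] act_comp[OF X(1) vertex_hom y(1,2)] le by (simp add: y(4) compose_vertex)
    then have "vertex (\<sigma> (\<alpha> i)) = vertex (\<sigma> (\<beta> i))"
      using inj_onD[OF inj _ vertices] vertices by (simp add: representing_map_def nerve_def)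
    then show ?thesis by (auto simp: vertex_def dest: fun_cong[of _ _ 0])
  qed
  then have "compose {..m} \<sigma> \<alpha> = compose {..m} \<sigma> \<beta>"
    by (auto simp: compose_def)
  then show ?thesis
    using act_comp[OF X(1) ab(1) y(1,2)] act_comp[OF X(1) ab(2) y(1,2)] y(4) by simp
qed

text \<open>An upward closed property that holds at \<open>n\<close> cuts out a final segment. This
  yields the index at which a chain in the cone leaves the apex.\<close>

lemma threshold:
  fixes n :: nat
  assumes "Q n" and "\<And>i j. Q i \<Longrightarrow> i \<le> j \<Longrightarrow> j \<le> n \<Longrightarrow> Q j"
  obtains k where "k \<le> n" "\<And>i. i \<le> n \<Longrightarrow> Q i \<longleftrightarrow> k \<le> i"
proof
  show "(LEAST i. Q i) \<le> n" using assms(1) by (rule Least_le)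
  show "Q i \<longleftrightarrow> (LEAST i. Q i) \<le> i" if "i \<le> n" for i
    using assms(2)[OF LeastI[of Q, OF assms(1)] _ that] Least_le[of Q i] by blast
qed


section \<open>Mapping cylinders\<close>

context
  fixes P :: "'a rel" and R :: "'b rel" and \<phi>
  assumes PR: "Partial_order P" "Partial_order R" and \<phi>: "\<phi> \<in> poset_hom P R"
begin

private abbreviation (input) "PI \<equiv> poset_prod P (ordinal 1)"
private abbreviation (input) "T \<equiv> top_cyl P R \<phi>"
private abbreviation (input) "M \<equiv> poset_pushout P PI R (cyl_i0 P) \<phi>"

definition cyl_inl :: "'a \<times> nat \<Rightarrow> ('a \<times> nat + 'b) set" where
  "cyl_inl = poset_pushout_inl P PI R (cyl_i0 P) \<phi>"

definition cyl_inr :: "'b \<Rightarrow> ('a \<times> nat + 'b) set" where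
  "cyl_inr = poset_pushout_inr P PI R (cyl_i0 P) \<phi>"

definition desing_cyl_inl where
  "desing_cyl_inl = sset_comp (nerve PI) (desing_unit T)
    (sset_pushout_inl (nerve P) (nerve PI) (nerve R) (nerve_map P (cyl_i0 P)) (nerve_map P \<phi>))"

definition desing_cyl_inr where
  "desing_cyl_inr = sset_comp (nerve R) (desing_unit T)
    (sset_pushout_inr (nerve P) (nerve PI) (nerve R) (nerve_map P (cyl_i0 P)) (nerve_map P \<phi>))"

private lemmas cyl_facts =
  PR(1) Partial_order_prod[OF PR(1) Partial_order_ordinal[of 1]] PR(2) cyl_i0_hom[OF PR(1)] \<phi>

private lemmas glue_facts =
  simplicial_set_nerve[of P] simplicial_set_nerve[of PI] simplicial_set_nerve[of R]
  nerve_map_hom[OF cyl_i0_hom[OF PR(1)]] nerve_map_hom[OF \<phi>]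

section \<open>The order of the reduced cylinder\<close>

lemma cyl_inl_hom: "cyl_inl \<in> poset_hom PI M"
  unfolding cyl_inl_def by (rule poset_pushout_inl_hom[OF cyl_facts])

lemma cyl_inr_hom: "cyl_inr \<in> poset_hom R M"
  unfolding cyl_inr_def by (rule poset_pushout_inr_hom[OF cyl_facts])

lemma Field_reduced_cyl: "Field M = cyl_inl ` Field PI \<union> cyl_inr ` Field R"
  unfolding Field_poset_pushout[OF cyl_facts]
  by (auto simp: cyl_inl_def cyl_inr_def poset_pushout_inl_def poset_pushout_inr_def)

lemma cyl_inl_0: "p \<in> Field P \<Longrightarrow> cyl_inl (p, 0) = cyl_inr (\<phi> p)"
  using fun_cong[OF poset_pushout_commutes[OF cyl_facts], of p]
  by (simp add: cyl_inl_def cyl_inr_def compose_def cyl_i0_def)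

text \<open>The gluing pairs involve only level 0, so every generating step out of level 1 comes
  from the order of the product, and it stays at level 1.\<close>

lemma glue_preorder_top:
  assumes "(Inl (p, 1), u) \<in> glue_preorder P PI R (cyl_i0 P) \<phi>"
  shows "\<exists>q. u = Inl (q, 1) \<and> (p, q) \<in> P"
  using assms unfolding glue_preorder_def
proof (induction rule: trancl_induct)
  case (base u)
  then show ?case by (auto simp: poset_prod_def ordinal_iff cyl_i0_def)
next
  case (step u v)
  then show ?case
    by (auto simp: poset_prod_def ordinal_iff cyl_i0_def dest: Partial_order_trans[OF PR(1)])
qed

text \<open>Comparing classes in the poset reflection amounts to comparing representatives in the
  generated preorder, where \<open>glue_preorder_top\<close> applies.\<close>

lemma cyl_inl_top_le:
  assumes p: "p \<in> Field P"
  shows "(cyl_inl (p, 1), cyl_inl z) \<in> M \<Longrightarrow> z \<in> Field PI \<Longrightarrow> snd z = 1 \<and> (p, fst z) \<in> P"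
    and "r \<in> Field R \<Longrightarrow> (cyl_inl (p, 1), cyl_inr r) \<notin> M"
proof -
  have pF: "(p, 1) \<in> Field PI"
    using p by (simp add: Field_poset_prod[OF PR(1) Partial_order_ordinal])
  note iff = poset_reflection_iff[OF glue_preorder_facts[OF cyl_facts], folded poset_pushout_def]
  show "snd z = 1 \<and> (p, fst z) \<in> P" if "(cyl_inl (p, 1), cyl_inl z) \<in> M" "z \<in> Field PI"
    using that pF glue_preorder_top[of p "Inl z"]
    by (auto simp: cyl_inl_def poset_pushout_inl_def iff InlI simp del: One_nat_def)
  show "(cyl_inl (p, 1), cyl_inr r) \<notin> M" if "r \<in> Field R"
    using that pF glue_preorder_top[of p "Inr r"]
    by (auto simp: cyl_inl_def cyl_inr_def poset_pushout_inl_def poset_pushout_inr_def iff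
        InlI InrI simp del: One_nat_def)
qed

section \<open>Simplices of the desingularized topological cylinder\<close>

lemma desing_cyl_inl_hom: "desing_cyl_inl \<in> sset_hom (nerve PI) (desing T)"
  unfolding desing_cyl_inl_def
  by (rule sset_comp_hom[OF simplicial_set_nerve
        sset_pushout_inl_hom[OF glue_facts, folded top_cyl_def]
        desing_unit_hom[OF simplicial_set_top_cyl[OF PR \<phi>]]])

lemma desing_cyl_inr_hom: "desing_cyl_inr \<in> sset_hom (nerve R) (desing T)"
  unfolding desing_cyl_inr_def
  by (rule sset_comp_hom[OF simplicial_set_nerve
        sset_pushout_inr_hom[OF glue_facts, folded top_cyl_def]
        desing_unit_hom[OF simplicial_set_top_cyl[OF PR \<phi>]]])

text \<open>This is the commutative pushout square, followed by the unit.\<close>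

lemma desing_cyl_inl_0:
  assumes a: "a \<in> simplices (nerve P) n"
  shows "desing_cyl_inl n (nerve_map P (cyl_i0 P) n a) = desing_cyl_inr n (nerve_map P \<phi> n a)"
  using fun_cong[OF fun_cong[OF sset_pushout_commutes[OF glue_facts]], of n a] a
    sset_hom_mem[OF glue_facts(4) a] sset_hom_mem[OF glue_facts(5) a]
  by (simp add: desing_cyl_inl_def desing_cyl_inr_def sset_comp_def compose_def)

text \<open>The unit and the projection from the coproduct to the pushout are both quotient maps, so
  the two legs are jointly surjective.\<close>

lemma desing_top_cyl_simplexE:
  assumes "c \<in> simplices (desing T) n"
  obtains (inl) x where "x \<in> simplices (nerve PI) n" "c = desing_cyl_inl n x"
    | (inr) r where "r \<in> simplices (nerve R) n" "c = desing_cyl_inr n r"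
proof -
  obtain t where t: "t \<in> simplices T n" "c = desing_unit T n t"
    using assms unfolding desing_def desing_unit_def sset_proj_def
    by (auto elim!: quotient_simplexE)
  then obtain s where s: "s \<in> simplices (sset_coprod (nerve PI) (nerve R)) n"
    "t = glue_rel (nerve P) (nerve PI) (nerve R) (nerve_map P (cyl_i0 P)) (nerve_map P \<phi>) n `` {s}"
    unfolding top_cyl_def sset_pushout_def by (auto elim!: quotient_simplexE)
  show thesis
  proof (cases s)
    case (Inl x)
    then show thesis
      using inl[of x] s t
      by (auto simp: sset_coprod_def desing_cyl_inl_def sset_comp_def compose_def
          sset_pushout_inl_def)
  next
    case (Inr r)
    then show thesis
      using inr[of r] s t
      by (auto simp: sset_coprod_def desing_cyl_inr_def sset_comp_def compose_def
          sset_pushout_inr_def)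
  qed
qed

section \<open>Values of \<open>dcr\<close> on representatives\<close>

lemma dcr_desing_unit: "t \<in> simplices T n \<Longrightarrow> dcr P R \<phi> n (desing_unit T n t) = cr P R \<phi> n t"
  using fun_cong[OF fun_cong[OF conjunct2[OF dcr_spec[OF PR \<phi>]]], of n t]
  by (simp add: sset_comp_def compose_def)

lemma dcr_desing_cyl_inl:
  assumes x: "x \<in> simplices (nerve PI) n"
  shows "dcr P R \<phi> n (desing_cyl_inl n x) = compose {..n} cyl_inl x"
  using fun_cong[OF fun_cong[OF cr_spec[OF PR \<phi>, THEN conjunct2, THEN conjunct1]], of n x] x
    dcr_desing_unit[unfolded top_cyl_def, OF sset_hom_mem[OF sset_pushout_inl_hom[OF glue_facts] x]]
  by (simp add: desing_cyl_inl_def sset_comp_def compose_def nerve_map_def cyl_inl_def top_cyl_def)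

lemma dcr_desing_cyl_inr:
  assumes r: "r \<in> simplices (nerve R) n"
  shows "dcr P R \<phi> n (desing_cyl_inr n r) = compose {..n} cyl_inr r"
  using fun_cong[OF fun_cong[OF cr_spec[OF PR \<phi>, THEN conjunct2, THEN conjunct2]], of n r] r
    dcr_desing_unit[unfolded top_cyl_def, OF sset_hom_mem[OF sset_pushout_inr_hom[OF glue_facts] r]]
  by (simp add: desing_cyl_inr_def sset_comp_def compose_def nerve_map_def cyl_inr_def top_cyl_def)

end


section \<open>Cones\<close>

definition const_simplex :: "nat \<Rightarrow> nat \<Rightarrow> nat" where
  "const_simplex n = (\<lambda>i \<in> {..n}. 0)"

lemma simplices_nerve_ordinal_0: "simplices (nerve (ordinal 0)) n = {const_simplex n}"
  by (auto simp: nerve_def poset_hom_ordinal_iff ordinal_iff const_simplex_def PiE_iff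
      extensional_def fun_eq_iff)

context
  fixes P :: "'a rel" and \<phi> :: "'a \<Rightarrow> nat"
  assumes P: "Partial_order P" and \<phi>: "\<phi> \<in> poset_hom P (ordinal 0)"
begin

private abbreviation (input) "CI \<equiv> poset_prod P (ordinal 1)"
private abbreviation (input) "D \<equiv> desing (top_cyl P (ordinal 0) \<phi>)"
private abbreviation (input) "C \<equiv> poset_pushout P CI (ordinal 0) (cyl_i0 P) \<phi>"
private abbreviation (input) "inl \<equiv> cyl_inl P (ordinal 0) \<phi>"
private abbreviation (input) "apex \<equiv> cyl_inr P (ordinal 0) \<phi> 0"
private abbreviation (input) "Dinl \<equiv> desing_cyl_inl P (ordinal 0) \<phi>"
private abbreviation (input) "Dapex n \<equiv> desing_cyl_inr P (ordinal 0) \<phi> n (const_simplex n)"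

private lemmas cone = P Partial_order_ordinal[of 0] \<phi>

section \<open>Simplices of the desingularized cone\<close>

lemma cone_inl_0: "p \<in> Field P \<Longrightarrow> inl (p, 0) = apex"
  using cyl_inl_0[OF cone] poset_hom_mem[OF \<phi>] by simp

lemma nerve_cyl_iff:
  "x \<in> simplices (nerve CI) n \<longleftrightarrow> x \<in> extensional {..n} \<and> (\<forall>i\<le>n. fst (x i) \<in> Field P) \<and>
    (\<forall>i j. i \<le> j \<longrightarrow> j \<le> n \<longrightarrow>
      (fst (x i), fst (x j)) \<in> P \<and> snd (x i) \<le> snd (x j) \<and> snd (x j) \<le> 1)"
proof -
  have le: "(u, v) \<in> CI \<longleftrightarrow> (fst u, fst v) \<in> P \<and> snd u \<le> snd v \<and> snd v \<le> 1" for u v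
    by (cases u, cases v) (simp add: poset_prod_def ordinal_iff)
  have "u \<in> Field CI \<longleftrightarrow> fst u \<in> Field P \<and> snd u \<le> 1" for u
    by (cases u) (simp add: Field_poset_prod[OF P Partial_order_ordinal])
  then show ?thesis
    by (simp add: nerve_def poset_hom_ordinal_iff PiE_iff le del: One_nat_def) blast
qed

text \<open>Levels increase along a chain, so level 0 at the last vertex puts the whole simplex in
  the copy of \<open>N P\<close> that is glued to the apex.\<close>

lemma cone_apex_simplex:
  assumes x: "x \<in> simplices (nerve CI) n" and "snd (x n) = 0"
  shows "Dinl n x = Dapex n"
proof -
  define a where "a = (\<lambda>i \<in> {..n}. fst (x i))"
  have a: "a \<in> simplices (nerve P) n"
    using x unfolding nerve_cyl_iff by (auto simp: a_def nerve_def poset_hom_ordinal_iff)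
  have "snd (x i) = 0" if "i \<le> n" for i
    using x assms(2) that unfolding nerve_cyl_iff by (metis le_zero_eq order_refl)
  then have "nerve_map P (cyl_i0 P) n a = x"
    using x a unfolding nerve_cyl_iff
    by (auto simp: nerve_map_def compose_def cyl_i0_def a_def extensional_def fun_eq_iff
        prod_eq_iff)
  moreover have "nerve_map P \<phi> n a = const_simplex n"
    using sset_hom_mem[OF nerve_map_hom[OF \<phi>] a] simplices_nerve_ordinal_0 by simp
  ultimately show ?thesis
    using desing_cyl_inl_0[OF cone a] by simp
qed

lemma desing_cone_simplexE:
  assumes "c \<in> simplices D n"
  obtains "c = Dapex n"
    | x where "x \<in> simplices (nerve CI) n" "snd (x n) = 1" "c = Dinl n x"
proof (rule desing_top_cyl_simplexE[OF cone assms])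
  fix x assume x: "x \<in> simplices (nerve CI) n" "c = Dinl n x"
  then have "snd (x n) = 0 \<or> snd (x n) = 1"
    unfolding nerve_cyl_iff by (metis le_neq_implies_less less_one order_refl)
  then show thesis using x that cone_apex_simplex by metis
next
  fix r assume "r \<in> simplices (nerve (ordinal 0)) n" "c = desing_cyl_inr P (ordinal 0) \<phi> n r"
  then show thesis using that(1) by (simp add: simplices_nerve_ordinal_0)
qed

text \<open>Meant for \<open>k\<close> the first index at level 1. The vertices before
  \<open>k\<close> lose their own positions in \<open>P\<close>, which is what passing to the apex
  forgets; the result is still a chain since \<open>(p, 0)\<close> lies below
  \<open>(p, 1)\<close>.\<close>

definition straighten :: "nat \<Rightarrow> nat \<Rightarrow> (nat \<Rightarrow> 'a \<times> nat) \<Rightarrow> nat \<Rightarrow> 'a \<times> nat" where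
  "straighten n k x = (\<lambda>i \<in> {..n}. if i < k then (fst (x k), 0) else x i)"

lemma desing_straighten:
  assumes x: "x \<in> simplices (nerve CI) n" and k: "k \<le> n"
    and lev: "\<And>i. i \<le> n \<Longrightarrow> snd (x i) = 1 \<longleftrightarrow> k \<le> i"
  shows "Dinl n x = Dinl n (straighten n k x)"
proof -
  \<comment> \<open>The simplex \<open>w\<close> inserts \<open>(fst (x k), 0)\<close> at position
    \<open>k\<close>, so \<open>x k\<close> moves to position \<open>k + 1\<close>. The operator
    \<delta> skips the new vertex and recovers \<open>x\<close>; \<gamma> sends every index below
    \<open>k\<close> to the new vertex and gives \<open>straighten n k x\<close>.\<close>
  define w where "w = (\<lambda>i \<in> {..Suc n}. if i < k then x i else if i = k then (fst (x k), 0)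
    else x (i - 1))"
  define \<delta> where "\<delta> = (\<lambda>i \<in> {..n}. if i < k then i else Suc i)"
  define \<gamma> where "\<gamma> = (\<lambda>i \<in> {..n}. if i < k then k else Suc i)"
  have xle: "(fst (x i), fst (x j)) \<in> P" "snd (x i) \<le> snd (x j)" if "i \<le> j" "j \<le> n" for i j
    using x that unfolding nerve_cyl_iff by auto
  have xm: "snd (x i) \<le> 1" "fst (x i) \<in> Field P" if "i \<le> n" for i
    using x that unfolding nerve_cyl_iff by auto
  have x0: "snd (x i) = 0" if "i < k" for i
    using lev[of i] xm(1)[of i] k that by fastforce
  have w: "w \<in> simplices (nerve CI) (Suc n)"
    unfolding nerve_cyl_iff using k xle xm x0 by (auto simp: w_def)
  have dg: "\<delta> \<in> Delta_hom n (Suc n)" "\<gamma> \<in> Delta_hom n (Suc n)"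
    using k by (auto simp: \<delta>_def \<gamma>_def poset_hom_ordinal_iff ordinal_iff)
  have act_w: "act D m (Suc n) \<alpha> (Dinl (Suc n) w) = Dinl m (compose {..m} w \<alpha>)"
    if "\<alpha> \<in> Delta_hom m (Suc n)" for m \<alpha>
    using sset_hom_act[OF desing_cyl_inl_hom[OF cone] that w] by (simp add: nerve_def)
  have apex_w: "act D 0 (Suc n) (vertex i) (Dinl (Suc n) w) = Dapex 0" if "i \<le> k" for i
  proof -
    have v: "vertex i \<in> Delta_hom 0 (Suc n)" using that k by (intro vertex_hom) simp
    have "snd (w i) = 0" using that k x0 by (auto simp: w_def)
    then show ?thesis
      using act_w[OF v] cone_apex_simplex[OF act_mem[OF simplicial_set_nerve v w]]
      by (simp add: nerve_def compose_def vertex_def)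
  qed
  \<comment> \<open>For \<open>i < k\<close> both operators pick a vertex of \<open>w\<close> that
    becomes the apex; for \<open>i \<ge> k\<close> they take the same value.\<close>
  have "act D n (Suc n) \<delta> (Dinl (Suc n) w) = act D n (Suc n) \<gamma> (Dinl (Suc n) w)"
  proof (rule nonsingular_act_eqI[OF simplicial_set_desing nonsingular_desing _ dg])
    show "simplicial_set (top_cyl P (ordinal 0) \<phi>)" "simplicial_set (top_cyl P (ordinal 0) \<phi>)"
      by (rule simplicial_set_top_cyl[OF cone])+
    show "Dinl (Suc n) w \<in> simplices D (Suc n)"
      by (rule sset_hom_mem[OF desing_cyl_inl_hom[OF cone] w])
    show "act D 0 (Suc n) (vertex (\<delta> i)) (Dinl (Suc n) w) =
        act D 0 (Suc n) (vertex (\<gamma> i)) (Dinl (Suc n) w)" if "i \<le> n" for i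
      using that apex_w[of i] apex_w[of k] by (auto simp: \<delta>_def \<gamma>_def)
  qed
  moreover have "compose {..n} w \<delta> = x"
    using x unfolding nerve_cyl_iff
    by (auto simp: compose_def w_def \<delta>_def extensional_def fun_eq_iff)
  moreover have "compose {..n} w \<gamma> = straighten n k x"
    using k by (auto simp: compose_def w_def \<gamma>_def straighten_def fun_eq_iff)
  ultimately show ?thesis using act_w dg by simp
qed

section \<open>The map from the desingularized cone to the reduced cone\<close>

lemma dcr_cone_apex: "dcr P (ordinal 0) \<phi> n (Dapex n) = (\<lambda>i \<in> {..n}. apex)"
  using dcr_desing_cyl_inr[OF cone, of "const_simplex n" n]
  by (simp add: simplices_nerve_ordinal_0 compose_def const_simplex_def cong: restrict_cong)

lemma dcr_cone_inl:
  "x \<in> simplices (nerve CI) n \<Longrightarrow> i \<le> n \<Longrightarrow> dcr P (ordinal 0) \<phi> n (Dinl n x) i = inl (x i)"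
  using dcr_desing_cyl_inl[OF cone, of x n] by (simp add: compose_def)

text \<open>By reflexivity, equality would put a top element below the apex.\<close>

lemma cone_inl_top_neq_apex: "p \<in> Field P \<Longrightarrow> inl (p, 1) \<noteq> apex"
  using cyl_inl_top_le(2)[OF cone, of p 0] poset_hom_mem[OF cyl_inr_hom[OF cone], of 0]
    Partial_order_refl[OF Partial_order_poset_pushout[OF P
        Partial_order_prod[OF P Partial_order_ordinal] Partial_order_ordinal
        cyl_i0_hom[OF P] \<phi>]]
  by auto

text \<open>Equality gives comparisons both ways. That \<open>z\<close> lies above
  \<open>(p, 1)\<close> forces \<open>z\<close> to level 1; the reverse comparison then takes place
  in \<open>P\<close>, and antisymmetry finishes.\<close>

lemma cone_inl_eq_top:
  assumes "p \<in> Field P" "z \<in> Field CI" "inl z = inl (p, 1)"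
  shows "z = (p, 1)"
proof -
  have F: "q \<in> Field P \<Longrightarrow> (q, 1) \<in> Field CI" for q
    by (simp add: Field_poset_prod[OF P Partial_order_ordinal])
  have r: "(inl (p, 1), inl (p, 1)) \<in> C"
    using F[OF assms(1)] poset_hom_mono[OF cyl_inl_hom[OF cone]]
      Partial_order_refl[OF Partial_order_prod[OF P Partial_order_ordinal]] by blast
  obtain q l where z: "z = (q, l)" by (cases z)
  have 1: "l = 1" "(p, q) \<in> P"
    using cyl_inl_top_le(1)[OF cone assms(1) _ assms(2)] r assms(3) z by auto
  then have "q \<in> Field P" by (auto intro: FieldI2)
  from cyl_inl_top_le(1)[OF cone this _ F[OF assms(1)]] have "(q, p) \<in> P"
    using r assms(3) z 1 by auto
  then show ?thesis using 1 z Partial_order_antisym[OF P] by auto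
qed

lemma Field_cone: "Field C = insert apex ((\<lambda>p. inl (p, 1)) ` Field P)"
proof -
  have "Field CI = Field P \<times> {0, 1}"
    by (auto simp: Field_poset_prod[OF P Partial_order_ordinal])
  then show ?thesis
    unfolding Field_reduced_cyl[OF cone] using cone_inl_0 by auto
qed

text \<open>Each simplex is the apex simplex or comes from a chain ending at level 1. The image of
  the last vertex separates the two kinds; within the second kind, equal images force equal
  straightened chains.\<close>

lemma inj_dcr_cone: "inj_on (dcr P (ordinal 0) \<phi> n) (simplices D n)"
proof -
  let ?d = "dcr P (ordinal 0) \<phi> n"
  have xF: "x i \<in> Field CI" "fst (x i) \<in> Field P" if "x \<in> simplices (nerve CI) n" "i \<le> n" for x i
    using that poset_hom_mem[of x "ordinal n" CI i]
    by (auto simp: nerve_def Field_poset_prod[OF P Partial_order_ordinal])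
  have top: "?d (Dinl n x) \<noteq> ?d (Dapex n)"
    if x: "x \<in> simplices (nerve CI) n" "snd (x n) = 1" for x
  proof -
    have "?d (Dinl n x) n \<noteq> apex"
      using x dcr_cone_inl[OF x(1), of n] xF[OF x(1), of n]
        cone_inl_top_neq_apex[of "fst (x n)"] by (cases "x n") auto
    then show ?thesis by (auto simp: dcr_cone_apex)
  qed
  have eq: "Dinl n x = Dinl n y"
    if x: "x \<in> simplices (nerve CI) n" "snd (x n) = 1"
      and y: "y \<in> simplices (nerve CI) n" "snd (y n) = 1"
      and d: "?d (Dinl n x) = ?d (Dinl n y)" for x y
  proof -
    have b: "inl (x i) = inl (y i)" if "i \<le> n" for i
      using dcr_cone_inl[OF x(1) that] dcr_cone_inl[OF y(1) that] d by simp
    \<comment> \<open>Where neither chain has level 1 both vertices map to the apex, so the images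
      do not determine their coordinates in \<open>P\<close>.\<close>
    have xy: "snd (x i) = 1 \<or> snd (y i) = 1 \<Longrightarrow> x i = y i" if "i \<le> n" for i
      using cone_inl_eq_top[OF xF(2)[OF x(1) that] xF(1)[OF y(1) that]]
        cone_inl_eq_top[OF xF(2)[OF y(1) that] xF(1)[OF x(1) that]] b[OF that]
      by (metis prod.collapse)
    have "snd (x j) = 1" if "snd (x i) = 1" "i \<le> j" "j \<le> n" for i j
      using x(1) that unfolding nerve_cyl_iff by (metis le_antisym)
    then obtain k where k: "k \<le> n" "\<And>i. i \<le> n \<Longrightarrow> snd (x i) = 1 \<longleftrightarrow> k \<le> i"
      using threshold[of "\<lambda>i. snd (x i) = 1" n] x(2) by metis
    then have k': "snd (y i) = 1 \<longleftrightarrow> k \<le> i" if "i \<le> n" for i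
      using xy that by metis
    \<comment> \<open>Straightening reads a chain only at indices from \<open>k\<close> on, where
      both chains are at level 1 and therefore agree.\<close>
    have "straighten n k x = straighten n k y"
      using k xy by (auto simp: straighten_def fun_eq_iff)
    then show ?thesis
      using desing_straighten[OF x(1) k] desing_straighten[OF y(1) k(1) k'] by simp
  qed
  show ?thesis
  proof (rule inj_onI)
    fix c d assume c: "c \<in> simplices D n" and d: "d \<in> simplices D n" and cd: "?d c = ?d d"
    show "c = d"
      using c
    proof (cases rule: desing_cone_simplexE)
      case 1
      show ?thesis
        using d by (cases rule: desing_cone_simplexE) (use 1 cd top in metis)+
    next
      case (2 x)
      show ?thesis
        using d by (cases rule: desing_cone_simplexE) (use 2 cd top eq in metis)+
    qed
  qed
qed

lemma cone_apex_mem: "Dapex n \<in> simplices D n"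
  using sset_hom_mem[OF desing_cyl_inr_hom[OF cone]] simplices_nerve_ordinal_0 by blast

text \<open>A chain in the reduced cone stays at the apex up to some index and then runs through top
  elements. A chain of top elements lifts uniquely to \<open>P\<close>, so only the initial stretch
  needs a choice.\<close>

lemma surj_dcr_cone:
  assumes "z \<in> simplices (red_cyl P (ordinal 0) \<phi>) n"
  shows "\<exists>c \<in> simplices D n. dcr P (ordinal 0) \<phi> n c = z"
proof -
  have z: "z \<in> poset_hom (ordinal n) C"
    using assms by (simp add: red_cyl_def nerve_def)
  then have zF: "z i \<in> Field C" if "i \<le> n" for i
    using poset_hom_mem[OF z] that by simp
  have zmono: "(z i, z j) \<in> C" if "i \<le> j" "j \<le> n" for i j
    using z that by (auto simp: poset_hom_ordinal_iff)
  have zext: "z \<in> extensional {..n}"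
    using poset_hom_extensional[OF z] by simp
  \<comment> \<open>Anything other than the apex is a top element, and no top element lies below the
    apex.\<close>
  have up: "z j \<noteq> apex" if "z i \<noteq> apex" "i \<le> j" "j \<le> n" for i j
    using zF[of i] zmono[OF that(2,3)] that cyl_inl_top_le(2)[OF cone, of _ 0]
    by (auto simp: Field_cone simp del: One_nat_def)
  show ?thesis
  proof (cases "z n = apex")
    case True
    then have "(\<lambda>i \<in> {..n}. apex) = z"
      using up zext by (auto simp: extensional_def fun_eq_iff)
    then show ?thesis using cone_apex_mem dcr_cone_apex by metis
  next
    case False
    then obtain k where k: "k \<le> n" "\<And>i. i \<le> n \<Longrightarrow> z i \<noteq> apex \<longleftrightarrow> k \<le> i"
      using threshold[of "\<lambda>i. z i \<noteq> apex" n] up by metis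
    have "\<exists>p. p \<in> Field P \<and> z i = inl (p, 1)" if "k \<le> i" "i \<le> n" for i
      using zF[OF that(2)] k(2)[OF that(2)] that(1) by (auto simp: Field_cone simp del: One_nat_def)
    then obtain p where p: "\<And>i. k \<le> i \<Longrightarrow> i \<le> n \<Longrightarrow> p i \<in> Field P \<and> z i = inl (p i, 1)"
      by metis
    have pmono: "(p i, p j) \<in> P" if "k \<le> i" "i \<le> j" "j \<le> n" for i j
      using cyl_inl_top_le(1)[OF cone, of "p i" "(p j, 1)"] p[of i] p[of j] zmono[of i j] that
      by (simp add: Field_poset_prod[OF P Partial_order_ordinal])
    \<comment> \<open>The initial vertices are lifted to the constant \<open>(p k, 0)\<close>, which
      lies below \<open>(p k, 1)\<close> and maps to the apex; the lift thus has the straightened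
      form.\<close>
    define x where "x = (\<lambda>i \<in> {..n}. if i < k then (p k, 0) else (p i, 1::nat))"
    have x: "x \<in> simplices (nerve CI) n"
      unfolding nerve_cyl_iff using k p pmono by (auto simp: x_def)
    have "dcr P (ordinal 0) \<phi> n (Dinl n x) = z"
    proof (rule extensionalityI[OF _ zext])
      show "dcr P (ordinal 0) \<phi> n (Dinl n x) \<in> extensional {..n}"
        using dcr_desing_cyl_inl[OF cone x] by (simp add: compose_def)
      fix i assume "i \<in> {..n}"
      then have i: "i \<le> n" by simp
      then show "dcr P (ordinal 0) \<phi> n (Dinl n x) i = z i"
        using dcr_cone_inl[OF x i] k(1) k(2)[OF i] p[of i] p[of k] cone_inl_0[of "p k"]
        by (cases "k \<le> i") (simp_all add: x_def)
    qed
    then show ?thesis using sset_hom_mem[OF desing_cyl_inl_hom[OF cone] x] by blast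
  qed
qed

lemma bij_dcr_cone:
  "bij_betw (dcr P (ordinal 0) \<phi> n) (simplices D n) (simplices (red_cyl P (ordinal 0) \<phi>) n)"
  unfolding bij_betw_def
  using inj_dcr_cone surj_dcr_cone sset_hom_mem[OF conjunct1[OF dcr_spec[OF cone]]]
  by (fastforce simp: image_iff)

end

theorem proposition7p1:
  fixes P :: "'a rel" and \<phi> :: "'a \<Rightarrow> nat"
  assumes "Partial_order P"
    and "\<phi> \<in> poset_hom P (ordinal 0)"
  shows "sset_iso (desing (top_cyl P (ordinal 0) \<phi>)) (red_cyl P (ordinal 0) \<phi>)
           (dcr P (ordinal 0) \<phi>)"
proof (rule sset_iso_if_bij_betw)
  note cone = assms(1) Partial_order_ordinal[of 0] assms(2)
  show "simplicial_set (desing (top_cyl P (ordinal 0) \<phi>))"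
    by (rule simplicial_set_desing[OF simplicial_set_top_cyl[OF cone]])
  show "dcr P (ordinal 0) \<phi> \<in> sset_hom (desing (top_cyl P (ordinal 0) \<phi>)) (red_cyl P (ordinal 0) \<phi>)"
    using dcr_spec[OF cone] by blast
qed (rule bij_dcr_cone[OF assms])

end
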